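(* Let $\lambda_0\in\mathbb{R}$ and let $g$ be any exchangeable prior distribution of $\tau_0$. A pseudo symmetric approximate design $d$ is ${\cal D}_{g,\lambda_0}$-optimal if and only if $q_d(x_d)>0$ and $$\max_{s\in{\cal S}}\left(\frac{1}{t-1}\frac{q_s(x_d)}{q_d(x_d)}+\frac{t-2}{t-1}\frac{q_s(\lambda_0)}{q_d(\lambda_0)}\right)=1.$$ Moreover, in that case every sequence $s$ in the design $d$ (i.e. with $p_s>0$) attains this maximum.
   Context: Fix integers $p\ge2$ (periods), $t\ge2$ (treatments), $n\ge1$ (subjects) and a symmetric positive definite real $p\times p$ matrix $\Sigma$ (within-subject covariance). $1_k$ is the all-ones vector of length $k$, $J_k=1_k1_k'$, $B_k=I_k-J_k/k$, prime denotes transpose, and $\tilde B=\Sigma^{-1}-\Sigma^{-1}J_p\Sigma^{-1}/(1_p'\Sigma^{-1}1_p)$. Let ${\cal S}=\{1,\dots,t\}^p$ be the set of treatment sequences. For $s=(t_1,\dots,t_p)\in{\cal S}$, $T_s$ is the $p\times t$ matrix with $(k,i)$ entry $1$ if $t_k=i$ and $0$ otherwise; $F_s$ is the $p\times t$ matrix with zero first row and, for $k\ge2$, $(k,i)$ entry $1$ if $t_{k-1}=i$ and $0$ otherwise. An (approximate) design $d$ is a vector $P_d=(p_s)_{s\in{\cal S}}$ with $p_s\ge0$, $\sum_sp_s=1$. For $1\le i,j\le2$ put $\hat C_{sij}=B_tG_{s,i}'\tilde BG_{s,j}B_t$ with $G_{s,1}=T_s$, $G_{s,2}=F_s$, $\hat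 C_{dij}=n\sum_sp_s\hat C_{sij}$, $C_{dij}=\hat C_{dij}-nG_i'\tilde BG_j$ with $G_1=\sum_sp_sT_sB_t$, $G_2=\sum_sp_sF_sB_t$; $c_{sij}=\mathrm{tr}(\hat C_{sij})$, $c_{dij}=n\sum_sp_sc_{sij}$; $q_s(x)=c_{s11}+2c_{s12}x+c_{s22}x^2$, $q_d(x)=\sum_sp_sq_s(x)$, $x_d=-c_{d12}/c_{d22}$. A design $d$ is pseudo symmetric if all treatments are equally replicated in each period (for all $k,i$: the sum of $p_s$ over sequences $s$ with $t_k=i$ is $1/t$) and the matrices $C_{dij}$, $1\le i,j\le2$, are completely symmetric (of the form $aI_t+bJ_t$). In the proportional model (carryover effects equal $\lambda$ times direct effects $\tau$), Fisher's information matrix for $\tau$ at $(\tau_0,\lambda_0)$ is $C_{d,\tau_0,\lambda_0}(\tau)=C_{d11}+\lambda_0(C_{d12}+C_{d21})+\lambda_0^2C_{d22}-(C_{d12}+\lambda_0C_{d22})\tau_0(\tau_0'C_{d22}\tau_0)^{-1}\tau_0'(C_{d21}+\lambda_0C_{d22})$, the last term being $0$ if $\tau_0'C_{d22}\tau_0=0$. The prior $g$ is a probability distribution on $\{\tau_0\in\mathbb{R}^t:1_t'\tau_0=0,\ \tau_0\ne0\}$; it is exchangeable if invariant under all permutations of coordinates. For a $t\times t$ nonnegative definite matrix $C$ with zero row and column sums and eigenvalues $0=a_0\le a_1\le\dots\le a_{t-1}$, $\Phi_D(C)=(\prod_{i=1}^{t-1}a_i)^{1/(t-1)}$. ${\cal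 D}_{g,\lambda_0}(d)=\mathbb{E}_g[\Phi_D(C_{d,\tau_0,\lambda_0}(\tau))]$, and a design is ${\cal D}_{g,\lambda_0}$-optimal if it maximizes this over all approximate designs. *)

theory Defs
  imports "HOL-Probability.Probability" "HOL-Computational_Algebra.Polynomial"
begin

text \<open>
  The periods are the elements, in increasing order, of a finite linearly ordered type \<open>'p\<close>, the
  treatments those of a finite type \<open>'t\<close>; thus \<open>p = CARD('p)\<close> and \<open>t = CARD('t)\<close>. A treatment
  sequence is a function \<open>'p \<Rightarrow> 't\<close> and an approximate design a weight function on sequences.
  A real \<open>p \<times> t\<close> matrix has type \<open>real^'t^'p\<close>, also written \<open>('p, 't) rmat\<close>.
\<close>

type_synonym ('m, 'n) rmat = "((real, 'n) vec, 'm) vec"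

type_synonym ('p, 't) design = "('p \<Rightarrow> 't) \<Rightarrow> real"

section \<open>Matrices\<close>

definition ones_vec :: "real^'k" where
  "ones_vec = (\<chi> i. 1)"

definition J_mat :: "real^'k^'k" where
  "J_mat = (\<chi> i j. 1)"

definition B_mat :: "real^'k^'k" where
  "B_mat = mat 1 - (1 / real CARD('k)) *\<^sub>R J_mat"

definition pos_definite :: "real^'k^'k \<Rightarrow> bool" where
  "pos_definite A \<longleftrightarrow> transpose A = A \<and> (\<forall>x. x \<noteq> 0 \<longrightarrow> x \<bullet> (A *v x) > 0)"

definition completely_symmetric :: "real^'k^'k \<Rightarrow> bool" where
  "completely_symmetric A \<longleftrightarrow> (\<exists>a b. A = a *\<^sub>R mat 1 + b *\<^sub>R J_mat)"

definition charpoly :: "real^'k^'k \<Rightarrow> real poly" where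
  "charpoly A = det (mat [:0, 1:] - (\<chi> i j. [:A $ i $ j:]))"

text \<open>The real eigenvalues in increasing order, repeated according to algebraic multiplicity. For a
  symmetric \<open>A\<close> the list has length \<open>CARD('k)\<close>.\<close>

definition eigenvalues :: "real^'k^'k \<Rightarrow> real list" where
  "eigenvalues A = sorted_list_of_multiset (proots (charpoly A))"

text \<open>\<open>tl\<close> drops the smallest eigenvalue \<open>a\<^sub>0\<close>, which is \<open>0\<close> for the nonnegative definite
  matrices with zero row and column sums to which the criterion is applied; if the eigenvalue \<open>0\<close> is
  multiple, the product vanishes.\<close>

definition Phi_D :: "real^'t^'t \<Rightarrow> real" where
  "Phi_D C = root (CARD('t) - 1) (prod_list (tl (eigenvalues C)))"

definition B_tilde :: "real^'p^'p \<Rightarrow> real^'p^'p" where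
  "B_tilde \<Sigma> = matrix_inv \<Sigma>
     - (1 / (ones_vec \<bullet> (matrix_inv \<Sigma> *v ones_vec))) *\<^sub>R (matrix_inv \<Sigma> ** J_mat ** matrix_inv \<Sigma>)"

section \<open>Sequences and designs\<close>

definition T_mat :: "('p \<Rightarrow> 't) \<Rightarrow> real^'t^'p" where
  "T_mat s = (\<chi> k i. if s k = i then 1 else 0)"

definition precedes :: "'p::linorder \<Rightarrow> 'p \<Rightarrow> bool" where
  "precedes l k \<longleftrightarrow> l < k \<and> \<not> (\<exists>m. l < m \<and> m < k)"

text \<open>The first period is preceded by no period, so the first row of the matrix is zero.\<close>

definition F_mat :: "('p::{finite,linorder} \<Rightarrow> 't::finite) \<Rightarrow> ('p, 't) rmat" where
  "F_mat s = (\<chi> k i. if \<exists>l. precedes l k \<and> s l = i then 1 else 0)"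

text \<open>The index of \<open>G_mat\<close>, and the indices below, range over \<open>{1, 2}\<close>.\<close>

definition G_mat :: "nat \<Rightarrow> ('p::{finite,linorder} \<Rightarrow> 't::finite) \<Rightarrow> ('p, 't) rmat" where
  "G_mat i s = (if i = 1 then T_mat s else F_mat s)"

definition is_design :: "('p::finite, 't::finite) design \<Rightarrow> bool" where
  "is_design d \<longleftrightarrow> (\<forall>s. d s \<ge> 0) \<and> (\<Sum>s\<in>UNIV. d s) = 1"

definition Chat_s ::
    "('p, 'p) rmat \<Rightarrow> nat \<Rightarrow> nat \<Rightarrow> ('p::{finite,linorder} \<Rightarrow> 't::finite) \<Rightarrow> ('t, 't) rmat" where
  "Chat_s \<Sigma> i j s = B_mat ** transpose (G_mat i s) ** B_tilde \<Sigma> ** G_mat j s ** B_mat"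

definition Chat_d ::
    "('p, 'p) rmat \<Rightarrow> nat \<Rightarrow> nat \<Rightarrow> nat \<Rightarrow> ('p::{finite,linorder}, 't::finite) design \<Rightarrow> ('t, 't) rmat" where
  "Chat_d \<Sigma> n i j d = real n *\<^sub>R (\<Sum>s\<in>UNIV. d s *\<^sub>R Chat_s \<Sigma> i j s)"

definition G_d :: "nat \<Rightarrow> ('p::{finite,linorder}, 't::finite) design \<Rightarrow> ('p, 't) rmat" where
  "G_d i d = (\<Sum>s\<in>UNIV. d s *\<^sub>R (G_mat i s ** B_mat))"

definition C_d ::
    "('p, 'p) rmat \<Rightarrow> nat \<Rightarrow> nat \<Rightarrow> nat \<Rightarrow> ('p::{finite,linorder}, 't::finite) design \<Rightarrow> ('t, 't) rmat" where
  "C_d \<Sigma> n i j d = Chat_d \<Sigma> n i j d - real n *\<^sub>R (transpose (G_d i d) ** B_tilde \<Sigma> ** G_d j d)"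

definition c_s :: "('p, 'p) rmat \<Rightarrow> nat \<Rightarrow> nat \<Rightarrow> ('p::{finite,linorder} \<Rightarrow> 't::finite) \<Rightarrow> real" where
  "c_s \<Sigma> i j s = trace (Chat_s \<Sigma> i j s)"

definition c_d ::
    "('p, 'p) rmat \<Rightarrow> nat \<Rightarrow> nat \<Rightarrow> nat \<Rightarrow> ('p::{finite,linorder}, 't::finite) design \<Rightarrow> real" where
  "c_d \<Sigma> n i j d = real n * (\<Sum>s\<in>UNIV. d s * c_s \<Sigma> i j s)"

definition q_s :: "('p, 'p) rmat \<Rightarrow> ('p::{finite,linorder} \<Rightarrow> 't::finite) \<Rightarrow> real \<Rightarrow> real" where
  "q_s \<Sigma> s x = c_s \<Sigma> 1 1 s + 2 * c_s \<Sigma> 1 2 s * x + c_s \<Sigma> 2 2 s * x\<^sup>2"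

definition q_d :: "('p, 'p) rmat \<Rightarrow> ('p::{finite,linorder}, 't::finite) design \<Rightarrow> real \<Rightarrow> real" where
  "q_d \<Sigma> d x = (\<Sum>s\<in>UNIV. d s * q_s \<Sigma> s x)"

definition x_d :: "('p, 'p) rmat \<Rightarrow> nat \<Rightarrow> ('p::{finite,linorder}, 't::finite) design \<Rightarrow> real" where
  "x_d \<Sigma> n d = - c_d \<Sigma> n 1 2 d / c_d \<Sigma> n 2 2 d"

definition pseudo_symmetric ::
    "('p, 'p) rmat \<Rightarrow> nat \<Rightarrow> ('p::{finite,linorder}, 't::finite) design \<Rightarrow> bool" where
  "pseudo_symmetric \<Sigma> n d \<longleftrightarrow>
     (\<forall>k i. (\<Sum>s | s k = i. d s) = 1 / real CARD('t)) \<and>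
     (\<forall>i\<in>{1, 2}. \<forall>j\<in>{1, 2}. completely_symmetric (C_d \<Sigma> n i j d))"

section \<open>Information matrix, priors and optimality\<close>

definition info_matrix ::
    "('p, 'p) rmat \<Rightarrow> nat \<Rightarrow> real^'t \<Rightarrow> real \<Rightarrow> ('p::{finite,linorder}, 't::finite) design \<Rightarrow> ('t, 't) rmat" where
  "info_matrix \<Sigma> n \<tau> lam d =
     (let C11 = C_d \<Sigma> n 1 1 d; C12 = C_d \<Sigma> n 1 2 d;
          C21 = C_d \<Sigma> n 2 1 d; C22 = C_d \<Sigma> n 2 2 d;
          c = \<tau> \<bullet> (C22 *v \<tau>);
          u = (C12 + lam *\<^sub>R C22) *v \<tau>;
          v = \<tau> v* (C21 + lam *\<^sub>R C22)
      in C11 + lam *\<^sub>R (C12 + C21) + lam\<^sup>2 *\<^sub>R C22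
           - (if c = 0 then 0 else (1 / c) *\<^sub>R (\<chi> i j. u $ i * v $ j)))"

definition is_prior :: "(real^'t) measure \<Rightarrow> bool" where
  "is_prior g \<longleftrightarrow> prob_space g \<and> sets g = sets borel \<and>
     (AE \<tau> in g. ones_vec \<bullet> \<tau> = 0 \<and> \<tau> \<noteq> 0)"

definition exchangeable :: "(real^'t) measure \<Rightarrow> bool" where
  "exchangeable g \<longleftrightarrow>
     (\<forall>\<pi>. \<pi> permutes UNIV \<longrightarrow> distr g borel (\<lambda>\<tau>. \<chi> i. \<tau> $ \<pi> i) = g)"

definition D_criterion ::
    "('p, 'p) rmat \<Rightarrow> nat \<Rightarrow> (real^'t) measure \<Rightarrow> real \<Rightarrow> ('p::{finite,linorder}, 't::finite) design \<Rightarrow> real" where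
  "D_criterion \<Sigma> n g lam d = (LINT \<tau>|g. Phi_D (info_matrix \<Sigma> n \<tau> lam d))"

definition D_optimal ::
    "('p, 'p) rmat \<Rightarrow> nat \<Rightarrow> (real^'t) measure \<Rightarrow> real \<Rightarrow> ('p::{finite,linorder}, 't::finite) design \<Rightarrow> bool" where
  "D_optimal \<Sigma> n g lam d \<longleftrightarrow>
     is_design d \<and> (\<forall>e. is_design e \<longrightarrow> D_criterion \<Sigma> n g lam e \<le> D_criterion \<Sigma> n g lam d)"

definition D_ratio ::
    "('p, 'p) rmat \<Rightarrow> nat \<Rightarrow> real \<Rightarrow> ('p::{finite,linorder}, 't::finite) design \<Rightarrow> ('p \<Rightarrow> 't) \<Rightarrow> real" where
  "D_ratio \<Sigma> n lam d s =
     1 / (real CARD('t) - 1) * (q_s \<Sigma> s (x_d \<Sigma> n d) / q_d \<Sigma> d (x_d \<Sigma> n d))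
     + (real CARD('t) - 2) / (real CARD('t) - 1) * (q_s \<Sigma> s lam / q_d \<Sigma> d lam)"

end

theory Submission imports Defs begin

text \<open>Write \<open>m = t - 1\<close>. In an orthonormal eigenbasis of \<open>C\<close>, two applications of the inequality between
  arithmetic and geometric means bound \<open>\<Phi>\<^sub>D(C)\<close> by \<open>(\<alpha> u + \<beta> (tr C - u)) / m\<close>, where \<open>u\<close> is the Rayleigh
  quotient of \<open>C\<close> at \<open>\<tau>\<^sub>0\<close> and \<open>\<alpha> \<beta>^(m - 1) = 1\<close>. Let \<open>K(x) = C\<^sub>d\<^sub>1\<^sub>1 + x (C\<^sub>d\<^sub>1\<^sub>2 + C\<^sub>d\<^sub>2\<^sub>1) + x\<^sup>2 C\<^sub>d\<^sub>2\<^sub>2\<close>.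
  If \<open>C\<close> is the information matrix of a design, then \<open>C \<le> K(\<lambda>\<^sub>0)\<close>, and \<open>u\<close> is at most the Rayleigh
  quotient of \<open>K(x)\<close> for every \<open>x\<close>. Exchangeability turns the expected Rayleigh quotients into
  traces, so the criterion of a design \<open>e\<close> is at most \<open>(n/m) (\<alpha> q\<^sub>e(x) + (m - 1) \<beta> q\<^sub>e(\<lambda>\<^sub>0)) / m\<close>.
  A pseudo symmetric design \<open>d\<close> attains \<open>n/m\<close> times the \<open>m\<close>-th root of \<open>q\<^sub>d(x\<^sub>d) q\<^sub>d(\<lambda>\<^sub>0)^(m - 1)\<close>;
  taking \<open>x = x\<^sub>d\<close> and \<open>\<alpha>\<close>, \<open>\<beta>\<close> inversely proportional to \<open>q\<^sub>d(x\<^sub>d)\<close>, \<open>q\<^sub>d(\<lambda>\<^sub>0)\<close> gives sufficiency.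
  For necessity, move from \<open>d\<close> towards the uniform design on the orbit of a sequence under
  relabelling the treatments: the mixture is again pseudo symmetric, and the derivative of its
  criterion at \<open>d\<close> yields the condition.\<close>

section \<open>Orthonormal eigenbases and the criterion \<open>\<Phi>\<^sub>D\<close>\<close>

text \<open>The form \<open>x \<bullet> f x\<close> attains its maximum on the compact unit sphere
  of \<open>S\<close>. A maximiser is an eigenvector, because the first variation of the form must
  vanish in every direction of \<open>S\<close>, including that of
  \<open>f x - M *\<^sub>R x\<close> itself.\<close>

lemma self_adjoint_has_eigenvector:
  fixes f :: "'a::euclidean_space \<Rightarrow> 'a"
  assumes "linear f" "subspace S" and inv: "\<And>x. x \<in> S \<Longrightarrow> f x \<in> S"
    and adj: "\<And>x y. x \<in> S \<Longrightarrow> y \<in> S \<Longrightarrow> x \<bullet> f y = f x \<bullet> y" and "S \<noteq> {0}"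
  obtains x where "x \<in> S" "norm x = 1" "f x = (x \<bullet> f x) *\<^sub>R x"
proof -
  interpret linear f by fact
  let ?K = "S \<inter> sphere 0 1"
  have "0 \<in> S" using \<open>subspace S\<close> by (rule subspace_0)
  then obtain z where z: "z \<in> S" "z \<noteq> 0" using \<open>S \<noteq> {0}\<close> by blast
  then have "inverse (norm z) *\<^sub>R z \<in> ?K"
    by (simp add: subspace_scale[OF \<open>subspace S\<close>])
  then have ne: "?K \<noteq> {}" by blast
  have comp: "compact ?K"
    using closed_subspace[OF \<open>subspace S\<close>] by (simp add: closed_Int_compact)
  have cont: "continuous_on ?K (\<lambda>x. x \<bullet> f x)"
    using \<open>linear f\<close> by (intro continuous_intros linear_continuous_on) (simp add: linear_conv_bounded_linear)
  obtain x where x: "x \<in> ?K" and max: "\<And>y. y \<in> ?K \<Longrightarrow> y \<bullet> f y \<le> x \<bullet> f x"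
    using continuous_attains_sup[OF comp ne cont] by blast
  define M where "M = x \<bullet> f x"
  have xS: "x \<in> S" and nx: "norm x = 1" and xx: "x \<bullet> x = 1"
    using x by (auto simp: dot_square_norm)
  have max': "y \<bullet> f y \<le> M * (y \<bullet> y)" if "y \<in> S" for y
  proof (cases "y = 0")
    case False
    have "inverse (norm y) *\<^sub>R y \<in> ?K"
      using False that by (simp add: subspace_scale[OF \<open>subspace S\<close>])
    from max[OF this] have "inverse (norm y) * (inverse (norm y) * (y \<bullet> f y)) \<le> M"
      by (simp add: M_def scale)
    then show ?thesis using False
      by (simp add: dot_square_norm power2_eq_square field_simps)
  qed (simp add: zero)
  have crit: "y \<bullet> (f x - M *\<^sub>R x) = 0" if "y \<in> S" for y
  proof (rule ccontr)
    define a where "a = y \<bullet> (f x - M *\<^sub>R x)"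
    define b where "b = M * (y \<bullet> y) - y \<bullet> f y"
    assume "\<not> ?thesis"
    then have a: "a \<noteq> 0" by (simp add: a_def)
    have ineq: "2 * e * a \<le> e\<^sup>2 * b" for e
    proof -
      have "x + e *\<^sub>R y \<in> S" using xS that \<open>subspace S\<close> by (simp add: subspace_add subspace_scale)
      from max'[OF this] adj[OF xS that] show ?thesis
        by (simp add: a_def b_def add scale inner_add_left inner_add_right inner_diff_right
            inner_commute[of y x] inner_commute[of y "f x"] xx M_def[symmetric] algebra_simps power2_eq_square)
    qed
    have "b \<ge> 0" using max'[OF that] by (simp add: b_def)
    \<comment> \<open>The inequality \<open>ineq\<close> holds for every step length, but its right
      side is of second order. The denominator is \<open>b + 1\<close> because \<open>b\<close> may
      be 0; this step gives \<open>e\<^sup>2 * (b + 2) \<le> 0\<close>.\<close>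
    define e where "e = a / (b + 1)"
    have e: "a = e * (b + 1)" "e \<noteq> 0" using a \<open>b \<ge> 0\<close> by (simp_all add: e_def)
    have "e\<^sup>2 * (b + 2) \<le> 0"
      using ineq[of e] unfolding e(1) by (simp add: algebra_simps power2_eq_square)
    moreover have "e\<^sup>2 * (b + 2) > 0" using e \<open>b \<ge> 0\<close> by simp
    ultimately show False by simp
  qed
  have "f x - M *\<^sub>R x \<in> S"
    using inv[OF xS] xS \<open>subspace S\<close> by (simp add: subspace_diff subspace_scale)
  from crit[OF this] have "f x = M *\<^sub>R x" by simp
  with that xS nx show ?thesis by (simp add: M_def)
qed

definition orthonormal :: "'a::euclidean_space set \<Rightarrow> bool" where
  "orthonormal B \<longleftrightarrow> pairwise orthogonal B \<and> (\<forall>b\<in>B. norm b = 1)"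

lemma orthonormal_insert:
  assumes "orthonormal B" "norm b = 1" "\<And>c. c \<in> B \<Longrightarrow> b \<bullet> c = 0"
  shows "orthonormal (insert b B)" "b \<notin> B"
proof -
  show "orthonormal (insert b B)"
    using assms by (auto simp: orthonormal_def pairwise_insert orthogonal_def inner_commute)
  show "b \<notin> B" using assms(2) assms(3)[of b] by auto
qed

lemma orthonormal_finite: "orthonormal B \<Longrightarrow> finite B"
  by (simp add: orthonormal_def pairwise_orthogonal_imp_finite)

lemma orthonormal_inner:
  "orthonormal B \<Longrightarrow> a \<in> B \<Longrightarrow> b \<in> B \<Longrightarrow> a \<bullet> b = (if a = b then 1 else 0)"
  by (auto simp: orthonormal_def pairwise_def orthogonal_def dot_square_norm)

text \<open>Induction on the dimension: split off a unit eigenvector; by self-adjointness its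
  orthogonal complement in \<open>S\<close> is again invariant. Working in a subspace, rather than
  the whole space, serves both this induction and the later extension of given eigenvectors.\<close>

theorem spectral_theorem:
  fixes f :: "'a::euclidean_space \<Rightarrow> 'a"
  assumes "linear f" "subspace S" "\<And>x. x \<in> S \<Longrightarrow> f x \<in> S"
    and "\<And>x y. x \<in> S \<Longrightarrow> y \<in> S \<Longrightarrow> x \<bullet> f y = f x \<bullet> y"
  shows "\<exists>B\<subseteq>S. orthonormal B \<and> card B = dim S \<and> (\<forall>b\<in>B. f b = (b \<bullet> f b) *\<^sub>R b)"
  using assms(2-)
proof (induction "dim S" arbitrary: S)
  case 0
  then show ?case by (intro exI[of _ "{}"]) (simp add: orthonormal_def)
next
  case (Suc k)
  then have "S \<noteq> {0}" by auto
  obtain x where x: "x \<in> S" "norm x = 1" "f x = (x \<bullet> f x) *\<^sub>R x"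
    using self_adjoint_has_eigenvector[OF assms(1) Suc.prems \<open>S \<noteq> {0}\<close>] by metis
  let ?T = "{y \<in> S. \<forall>z\<in>span {x}. orthogonal z y}"
  have T: "?T = {y \<in> S. x \<bullet> y = 0}"
  proof -
    have "(\<forall>z\<in>span {x}. orthogonal z y) \<longleftrightarrow> x \<bullet> y = 0" for y
      by (auto simp: orthogonal_def span_singleton)
    then show ?thesis by simp
  qed
  have "dim ?T + dim (span {x}) = dim S"
    using dim_subspace_orthogonal_to_vectors[of "span {x}" S] Suc.prems(1) x(1)
    by (simp add: span_minimal)
  moreover have "dim (span {x}) = 1" using x(2) by (auto simp: dim_span dim_singleton)
  ultimately have dimT: "k = dim ?T" using Suc.hyps(2) by simp
  have subT: "subspace ?T" unfolding T using Suc.prems(1)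
    by (auto simp: subspace_def inner_add_right)
  have invT: "f y \<in> ?T" if "y \<in> ?T" for y
  proof -
    have "x \<bullet> f y = f x \<bullet> y" using Suc.prems(3) x that by (simp add: T)
    also have "\<dots> = 0" using that by (subst x(3)) (simp add: T)
    finally show ?thesis using that Suc.prems(2) by (simp add: T)
  qed
  obtain B where B: "B \<subseteq> ?T" "orthonormal B" "card B = dim ?T" "\<forall>b\<in>B. f b = (b \<bullet> f b) *\<^sub>R b"
    using Suc.hyps(1)[OF dimT subT invT] Suc.prems(3) by (metis (no_types, lifting) mem_Collect_eq)
  have xB: "\<And>c. c \<in> B \<Longrightarrow> x \<bullet> c = 0" using B(1) by (auto simp: T)
  note ins = orthonormal_insert[OF B(2) x(2) xB]
  have "card (insert x B) = dim S"
    using ins(2) orthonormal_finite[OF B(2)] B(3) dimT Suc.hyps(2) by simp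
  then show ?case using ins(1) B(1,4) x by (intro exI[of _ "insert x B"]) auto
qed

section \<open>Characteristic polynomial and \<open>Phi_D\<close> in an orthonormal
  eigenbasis\<close>

lemma matrix_mult_nth: "(A ** B) $ i $ j = (\<Sum>k\<in>UNIV. A $ i $ k * B $ k $ j)"
  by (simp add: matrix_matrix_mult_def)

text \<open>Entries become constant polynomials. Multiplicativity of this embedding carries the
  diagonalisation of a real matrix over to the matrix inside \<open>charpoly\<close>.\<close>

lemma lift_matrix_mult:
  fixes A :: "real^'n^'m" and B :: "real^'k^'n"
  shows "(\<chi> i j. [:(A ** B) $ i $ j:]) = (\<chi> i j. [:A $ i $ j:]) ** (\<chi> i j. [:B $ i $ j:])"
proof -
  have "[:sum f S:] = (\<Sum>k\<in>S. [:f k:])" for f :: "'n \<Rightarrow> real" and S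
  proof (induction S rule: infinite_finite_induct)
    case (insert x F)
    then show ?case by (metis add.right_neutral add_pCons sum.insert)
  qed simp_all
  then show ?thesis
    by (simp add: matrix_matrix_mult_def vec_eq_iff mult.commute)
qed

text \<open>Take the basis vectors as the rows of \<open>U\<close>. Then \<open>U\<close> times its
  transpose is the identity, and conjugation by \<open>U\<close> makes \<open>A\<close> diagonal.
  Scalar matrices commute with \<open>U\<close>, so the same conjugation diagonalises the polynomial
  matrix without changing its determinant.\<close>

lemma charpoly_orthonormal_eigenbasis:
  fixes A :: "real^'k^'k"
  assumes B: "orthonormal B" "card B = CARD('k)" "\<And>b. b \<in> B \<Longrightarrow> A *v b = D b *\<^sub>R b"
  shows "charpoly A = (\<Prod>b\<in>B. [:- D b, 1:])"
proof -
  obtain e where e: "bij_betw e (UNIV :: 'k set) B"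
    using B(2) orthonormal_finite[OF B(1)] finite_same_card_bij[of "UNIV :: 'k set" B] by auto
  have eB: "e i \<in> B" for i using e by (auto simp: bij_betw_def)
  have einj: "e i = e j \<longleftrightarrow> i = j" for i j using e by (auto simp: bij_betw_def inj_on_def)
  define U :: "real^'k^'k" where "U = (\<chi> i. e i)"
  have UU: "U ** transpose U = mat 1"
    using orthonormal_inner[OF B(1) eB eB] einj
    by (simp add: vec_eq_iff matrix_matrix_mult_def U_def transpose_def mat_def inner_vec_def)
  have UAU: "U ** A ** transpose U = (\<chi> i j. if i = j then D (e i) else 0)"
  proof -
    have "(U ** (A ** transpose U)) $ i $ j = (if i = j then D (e i) else 0)" for i j
    proof -
      have "(A ** transpose U) $ k $ j = (A *v e j) $ k" for k
        by (simp add: matrix_matrix_mult_def matrix_vector_mult_def U_def transpose_def)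
      then have "(U ** (A ** transpose U)) $ i $ j = e i \<bullet> (A *v e j)"
        unfolding matrix_mult_nth[of U] by (simp add: U_def inner_vec_def)
      also have "\<dots> = D (e j) * (e i \<bullet> e j)" by (simp add: B(3)[OF eB])
      also have "\<dots> = (if i = j then D (e i) else 0)"
        by (auto simp: orthonormal_inner[OF B(1) eB eB] einj)
      finally show ?thesis .
    qed
    then show ?thesis by (simp add: vec_eq_iff matrix_mul_assoc)
  qed
  let ?L = "\<lambda>M :: real^'k^'k. (\<chi> i j. [:M $ i $ j:]) :: real poly^'k^'k"
  let ?X = "mat [:0, 1:] :: real poly^'k^'k"
  have "M ** ?X = (\<chi> i j. [:0, 1:] * M $ i $ j)" "?X ** M = (\<chi> i j. [:0, 1:] * M $ i $ j)" for M
    by (simp_all add: matrix_matrix_mult_def mat_def vec_eq_iff if_distrib if_distribR cong: if_cong)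
  then have X: "M ** ?X = ?X ** M" for M by simp
  have one: "?L U ** ?L (transpose U) = mat 1"
    unfolding lift_matrix_mult[symmetric] UU by (simp add: mat_def vec_eq_iff)
  have conj: "?L U ** (?X - ?L A) ** ?L (transpose U) = (\<chi> i j. if i = j then [:- D (e i), 1:] else 0)"
  proof -
    have "?L U ** (?X - ?L A) ** ?L (transpose U)
        = ?L U ** ?X ** ?L (transpose U) - ?L U ** ?L A ** ?L (transpose U)"
      by (simp add: matrix_mult_nth vec_eq_iff sum_subtractf algebra_simps)
    also have "?L U ** ?X ** ?L (transpose U) = ?X"
      by (simp only: X[of "?L U"] one matrix_mul_rid flip: matrix_mul_assoc)
    also have "?L U ** ?L A ** ?L (transpose U) = ?L (U ** A ** transpose U)"
      by (simp add: lift_matrix_mult)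
    finally show ?thesis by (simp add: UAU vec_eq_iff mat_def)
  qed
  have "det (?X - ?L A) = det (?X - ?L A) * det (?L U ** ?L (transpose U))"
    by (simp add: one)
  also have "\<dots> = det (?L U ** (?X - ?L A) ** ?L (transpose U))"
    by (simp add: det_mul mult_ac)
  also have "\<dots> = (\<Prod>i\<in>UNIV. [:- D (e i), 1:])"
    unfolding conj by (subst det_diagonal) auto
  also have "\<dots> = (\<Prod>b\<in>B. [:- D b, 1:])"
    by (rule prod.reindex_bij_betw[OF e])
  finally show ?thesis by (simp add: charpoly_def)
qed

text \<open>The eigenvalue list is the sorted multiset of the values of \<open>D\<close>. All of
  them are nonnegative and 0 occurs, so the entry dropped by \<open>tl\<close> is a 0 and may be
  taken to be the one belonging to \<open>b0\<close>.\<close>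

lemma Phi_D_orthonormal_eigenbasis:
  fixes A :: "real^'k^'k"
  assumes B: "orthonormal B" "card B = CARD('k)" "\<And>b. b \<in> B \<Longrightarrow> A *v b = D b *\<^sub>R b"
    and nonneg: "\<And>b. b \<in> B \<Longrightarrow> D b \<ge> 0" and b0: "b0 \<in> B" "D b0 = 0"
  shows "Phi_D A = root (CARD('k) - 1) (\<Prod>b\<in>B - {b0}. D b)"
proof -
  have fin: "finite B" using B(1) by (rule orthonormal_finite)
  have "charpoly A = (\<Prod>b\<in>B. [:- D b, 1:])"
    by (rule charpoly_orthonormal_eigenbasis[OF B])
  then have "proots (charpoly A) = (\<Sum>b\<in>B. proots [:- D b, 1:])"
    by (simp add: proots_prod del: proots_linear_factor)
  also have "\<dots> = image_mset D (mset_set B)"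
    using fin by (induction B rule: finite_induct) simp_all
  finally have roots: "proots (charpoly A) = image_mset D (mset_set B)" .
  define xs where "xs = eigenvalues A"
  have mset_xs: "mset xs = image_mset D (mset_set B)" and "sorted xs"
    by (simp_all add: xs_def eigenvalues_def roots)
  have set_xs: "set xs = D ` B" using arg_cong[OF mset_xs, of set_mset] fin by simp
  then obtain y ys where xs: "xs = y # ys" using b0 by (cases xs) auto
  have "y = 0"
  proof -
    have "0 \<in> set xs" using set_xs b0 by force
    then have "y \<le> 0" using \<open>sorted xs\<close> xs by auto
    moreover have "y \<in> D ` B" using set_xs xs by auto
    then have "y \<ge> 0" using nonneg by auto
    ultimately show ?thesis by simp
  qed
  then have "mset ys = image_mset D (mset_set B) - {#0#}"
    using mset_xs xs by (metis add_mset_remove_trivial mset.simps(2))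
  also have "\<dots> = image_mset D (mset_set (B - {b0}))"
    using fin b0 by (simp add: mset_set.remove[of B b0])
  finally have "prod_list ys = (\<Prod>b\<in>B - {b0}. D b)"
    by (simp add: prod_unfold_prod_mset flip: prod_mset_prod_list)
  then show ?thesis by (simp add: Phi_D_def xs_def[symmetric] xs)
qed

section \<open>Prescribed eigenvectors, Parseval's identity and the trace\<close>

text \<open>The orthogonal complement of a set of eigenvectors is invariant under a self-adjoint
  map, so \<open>spectral_theorem\<close> applies there. This allows the all-ones direction, and a
  second direction where required, to be put into the eigenbasis.\<close>

lemma extend_orthonormal_eigenbasis:
  fixes f :: "'a::euclidean_space \<Rightarrow> 'a"
  assumes f: "linear f" "\<And>x y. x \<bullet> f y = f x \<bullet> y"
    and A: "orthonormal A" "\<And>a. a \<in> A \<Longrightarrow> f a = (a \<bullet> f a) *\<^sub>R a"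
  obtains B where "A \<subseteq> B" "orthonormal B" "card B = DIM('a)"
    "\<And>b. b \<in> B \<Longrightarrow> f b = (b \<bullet> f b) *\<^sub>R b"
proof -
  let ?S = "{y \<in> UNIV. \<forall>x\<in>span A. orthogonal x y}"
  have S: "?S = {y. \<forall>a\<in>A. a \<bullet> y = 0}"
  proof (intro equalityI subsetI)
    fix y assume "y \<in> {y. \<forall>a\<in>A. a \<bullet> y = 0}"
    then have "orthogonal y a" if "a \<in> A" for a
      using that by (simp add: orthogonal_def inner_commute[of y])
    then show "y \<in> ?S" using orthogonal_to_span[of _ A y] by (simp add: orthogonal_commute)
  qed (simp add: orthogonal_def span_base)
  have "0 \<notin> A" using A(1) by (auto simp: orthonormal_def)
  then have "independent A" using A(1) by (simp add: orthonormal_def pairwise_orthogonal_independent)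
  then have dim: "dim ?S + card A = DIM('a)"
    using dim_subspace_orthogonal_to_vectors[of "span A" "UNIV :: 'a set"]
    by (simp add: dim_eq_card_independent)
  have sub: "subspace ?S" unfolding S by (auto simp: subspace_def inner_add_right)
  have inv: "f y \<in> ?S" if "y \<in> ?S" for y
  proof -
    have "a \<bullet> f y = 0" if "a \<in> A" for a
    proof -
      have "a \<bullet> f y = (a \<bullet> f a) * (a \<bullet> y)" using A(2)[OF that] f(2)[of a y]
        by (metis inner_scaleR_left)
      then show ?thesis using \<open>y \<in> ?S\<close> that unfolding S by simp
    qed
    then show ?thesis unfolding S by simp
  qed
  obtain B where B: "B \<subseteq> ?S" "orthonormal B" "card B = dim ?S" "\<forall>b\<in>B. f b = (b \<bullet> f b) *\<^sub>R b"
    using spectral_theorem[OF f(1) sub inv f(2)] by auto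
  have perp: "a \<bullet> b = 0" if "a \<in> A" "b \<in> B" for a b using B(1) that unfolding S by auto
  have "A \<inter> B = {}"
    using perp A(1) by (fastforce simp: orthonormal_def)
  then have "card (A \<union> B) = DIM('a)"
    using dim B(3) by (simp add: card_Un_disjoint orthonormal_finite A(1) B(2))
  moreover have "orthonormal (A \<union> B)"
    using A(1) B(2) perp by (auto simp: orthonormal_def pairwise_def orthogonal_def) (metis inner_commute)
  ultimately show ?thesis using that[of "A \<union> B"] A(2) B(4) by blast
qed

text \<open>The remainder \<open>z\<close> of the expansion of \<open>x\<close> is orthogonal to
  \<open>B\<close>, hence to its span, which is the whole space; so it is orthogonal to itself and
  vanishes.\<close>

lemma orthonormal_parseval:
  fixes x y :: "'a::euclidean_space"
  assumes "orthonormal B" "card B = DIM('a)"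
  shows "x \<bullet> y = (\<Sum>b\<in>B. (x \<bullet> b) * (y \<bullet> b))"
proof -
  have fin: "finite B" using assms(1) by (rule orthonormal_finite)
  have "0 \<notin> B" using assms(1) by (auto simp: orthonormal_def)
  then have "independent B" using assms(1) by (simp add: orthonormal_def pairwise_orthogonal_independent)
  then have span: "span B = UNIV"
    using assms(2) by (metis dim_UNIV dim_eq_card_independent dim_eq_full dim_span)
  define z where "z = x - (\<Sum>b\<in>B. (x \<bullet> b) *\<^sub>R b)"
  have "orthogonal z c" if "c \<in> B" for c
  proof -
    have "(\<Sum>b\<in>B. (x \<bullet> b) *\<^sub>R b) \<bullet> c = (\<Sum>b\<in>B. if b = c then x \<bullet> c else 0)"
      unfolding inner_sum_left
      by (intro sum.cong) (auto simp: orthonormal_inner[OF assms(1) _ that])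
    then show ?thesis using that fin by (simp add: z_def orthogonal_def inner_diff_left)
  qed
  then have "orthogonal z z" using orthogonal_to_span[of z B z] span by auto
  then have "x = (\<Sum>b\<in>B. (x \<bullet> b) *\<^sub>R b)" by (simp add: z_def orthogonal_def)
  then have "x \<bullet> y = (\<Sum>b\<in>B. (x \<bullet> b) *\<^sub>R b) \<bullet> y" by simp
  then show ?thesis by (simp add: inner_sum_left inner_commute[of y])
qed

text \<open>Parseval's identity for two coordinate vectors says that the products
  \<open>b $ i * b $ j\<close>, summed over the basis, give the identity matrix. After exchanging
  sums only the diagonal of \<open>A\<close> survives.\<close>

lemma trace_orthonormal_basis:
  fixes A :: "real^'k^'k"
  assumes "orthonormal B" "card B = CARD('k)"
  shows "trace A = (\<Sum>b\<in>B. b \<bullet> (A *v b))"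
proof -
  have ax: "axis i 1 \<bullet> axis j (1::real) = (\<Sum>b\<in>B. b $ i * b $ j)" for i j :: 'k
    using orthonormal_parseval[of B "axis i 1" "axis j (1::real)"] assms by (simp add: inner_axis')
  have "(\<Sum>b\<in>B. b \<bullet> (A *v b)) = (\<Sum>b\<in>B. \<Sum>i\<in>UNIV. \<Sum>j\<in>UNIV. A $ i $ j * (b $ i * b $ j))"
    by (simp add: inner_vec_def matrix_vector_mult_def sum_distrib_left mult_ac)
  also have "\<dots> = (\<Sum>i\<in>UNIV. \<Sum>j\<in>UNIV. \<Sum>b\<in>B. A $ i $ j * (b $ i * b $ j))"
    by (subst sum.swap, intro sum.cong refl, rule sum.swap)
  also have "\<dots> = (\<Sum>i\<in>UNIV. \<Sum>j\<in>UNIV. if j = i then A $ i $ j else 0)"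
    by (intro sum.cong refl) (simp add: ax[symmetric] inner_axis_axis flip: sum_distrib_left)
  also have "\<dots> = trace A" by (simp add: trace_def)
  finally show ?thesis by simp
qed

section \<open>Bounds and exact values of \<open>Phi_D\<close>\<close>

text \<open>Convexity of the exponential bounds each factor below by \<alpha> to the power
  \<open>p b\<close> times \<beta> to the power \<open>1 - p b\<close>. Over all of \<open>B\<close>
  these exponents add up to 1 and \<open>card B - 1\<close>, and the product of the bounds is 1 by
  \<open>norm\<close>.\<close>

lemma prod_affine_ge_1:
  fixes p :: "'a \<Rightarrow> real"
  assumes B: "finite B" and p: "\<And>b. b \<in> B \<Longrightarrow> 0 \<le> p b" "(\<Sum>b\<in>B. p b) = 1"
    and \<alpha>: "\<alpha> > 0" and \<beta>: "\<beta> > 0" and norm: "\<alpha> * \<beta> ^ (card B - 1) = 1"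
  shows "(\<Prod>b\<in>B. \<alpha> * p b + \<beta> * (1 - p b)) \<ge> 1"
    and "b \<in> B \<Longrightarrow> \<alpha> * p b + \<beta> * (1 - p b) > 0"
proof -
  have p1: "p b \<le> 1" if "b \<in> B" for b
    using member_le_sum[OF that _ B, of p] p by simp
  have ge: "\<alpha> * p b + \<beta> * (1 - p b) \<ge> exp (p b * ln \<alpha> + (1 - p b) * ln \<beta>)" if "b \<in> B" for b
    using convex_onD[OF exp_convex, of "1 - p b" "ln \<alpha>" "ln \<beta>"] p(1)[OF that] p1[OF that] \<alpha> \<beta>
    by (simp add: mult.commute)
  show "\<alpha> * p b + \<beta> * (1 - p b) > 0" if "b \<in> B" for b
    using ge[OF that] by (rule less_le_trans[OF exp_gt_zero])
  have "B \<noteq> {}" using p(2) by auto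
  then have "card B \<ge> 1" using B by (simp add: Suc_le_eq card_gt_0_iff)
  then have "(\<Sum>b\<in>B. p b * ln \<alpha> + (1 - p b) * ln \<beta>) = ln \<alpha> + (card B - 1) * ln \<beta>"
    using p(2) by (simp add: sum.distrib sum_subtractf algebra_simps flip: sum_distrib_left)
  also have "\<dots> = ln (\<alpha> * \<beta> ^ (card B - 1))"
    using \<alpha> \<beta> by (simp add: ln_mult ln_realpow)
  finally have "1 = exp (\<Sum>b\<in>B. p b * ln \<alpha> + (1 - p b) * ln \<beta>)"
    unfolding norm by simp
  also have "\<dots> \<le> (\<Prod>b\<in>B. \<alpha> * p b + \<beta> * (1 - p b))"
    unfolding exp_sum[OF B] by (intro prod_mono) (simp add: ge)
  finally show "(\<Prod>b\<in>B. \<alpha> * p b + \<beta> * (1 - p b)) \<ge> 1" .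
qed

lemma root_arith_geom_mean:
  fixes x :: "'a \<Rightarrow> real"
  assumes "finite S" "S \<noteq> {}" "\<And>i. i \<in> S \<Longrightarrow> 0 \<le> x i"
  shows "root (card S) (\<Prod>i\<in>S. x i) \<le> (\<Sum>i\<in>S. x i) / card S"
proof -
  have "card S > 0" using assms(1,2) by (simp add: card_gt_0_iff)
  then have "root (card S) (\<Prod>i\<in>S. x i) = (\<Prod>i\<in>S. x i) powr (1 / card S)"
    using prod_nonneg[of S x] assms(3) by (cases "(\<Prod>i\<in>S. x i) = 0") (auto simp: root_powr_inverse)
  with arith_geom_mean[OF assms] show ?thesis by (simp flip: sum_divide_distrib)
qed

lemma ones_vec_inner: "ones_vec \<bullet> (x :: real^'k) = (\<Sum>i\<in>UNIV. x $ i)"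
  by (simp add: ones_vec_def inner_vec_def)

lemma norm_ones_vec: "norm (ones_vec :: real^'k) = sqrt (real CARD('k))"
  by (simp add: norm_eq_sqrt_inner ones_vec_inner) (simp add: ones_vec_def)

lemma B_mat_mult_vec: "B_mat *v x = x - (ones_vec \<bullet> x / real CARD('k)) *\<^sub>R (ones_vec :: real^'k)"
proof -
  have "J_mat *v x = (ones_vec \<bullet> x) *\<^sub>R (ones_vec :: real^'k)"
    by (simp add: vec_eq_iff matrix_vector_mult_def J_mat_def ones_vec_inner) (simp add: ones_vec_def)
  then show ?thesis
    by (simp add: B_mat_def matrix_vector_mult_diff_rdistrib flip: scaleR_matrix_vector_assoc)
qed

lemma self_adjoint_of_symmetric:
  fixes C :: "real^'k^'k"
  shows "transpose C = C \<Longrightarrow> x \<bullet> (C *v y) = (C *v x) \<bullet> y"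
  by (metis dot_lmul_matrix vector_transpose_matrix)

text \<open>In an orthonormal eigenbasis the right-hand side becomes the mean of the eigenvalues weighted
  by the entries of a convex combination, and these weights have product at least 1.\<close>

lemma Phi_D_le:
  fixes C :: "real^'t^'t" and \<tau> :: "real^'t"
  assumes t: "CARD('t) \<ge> 2" and sym: "transpose C = C" and psd: "\<And>x. 0 \<le> x \<bullet> (C *v x)"
    and C1: "C *v ones_vec = 0" and \<tau>: "ones_vec \<bullet> \<tau> = 0" "\<tau> \<noteq> 0"
    and \<alpha>\<beta>: "\<alpha> > 0" "\<beta> > 0" "\<alpha> * \<beta> ^ (CARD('t) - 2) = 1"
  defines "u \<equiv> \<tau> \<bullet> (C *v \<tau>) / (\<tau> \<bullet> \<tau>)"
  shows "Phi_D C \<le> (\<alpha> * u + \<beta> * (trace C - u)) / (real CARD('t) - 1)"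
proof -
  define b0 where "b0 = (1 / sqrt (real CARD('t))) *\<^sub>R (ones_vec :: real^'t)"
  have b0: "orthonormal {b0}" by (simp add: orthonormal_def b0_def norm_ones_vec)
  have Cb0: "C *v b0 = 0" by (simp add: b0_def matrix_vector_mult_scaleR C1)
  obtain B where B: "{b0} \<subseteq> B" "orthonormal B" "card B = CARD('t)"
      "\<And>b. b \<in> B \<Longrightarrow> C *v b = (b \<bullet> (C *v b)) *\<^sub>R b"
    by (rule extend_orthonormal_eigenbasis[of "(*v) C", OF _ self_adjoint_of_symmetric[OF sym] b0])
      (simp_all add: Cb0)
  define D where "D b = b \<bullet> (C *v b)" for b
  \<comment> \<open>The squared cosine of the angle between \<tau> and \<open>b\<close>. As \<tau>
    is orthogonal to \<open>b0\<close>, these values already sum to 1 over the remaining basis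
    vectors, and the eigenvalues averaged with them give \<open>u\<close>.\<close>
  define p where "p b = (\<tau> \<bullet> b)\<^sup>2 / (\<tau> \<bullet> \<tau>)" for b
  let ?B = "B - {b0}"
  have fin: "finite ?B" using orthonormal_finite[OF B(2)] by simp
  have D0: "D b \<ge> 0" for b by (simp add: D_def psd)
  have Db0: "D b0 = 0" by (simp add: D_def Cb0)
  have Phi: "Phi_D C = root (CARD('t) - 1) (\<Prod>b\<in>?B. D b)"
    by (rule Phi_D_orthonormal_eigenbasis[OF B(2,3) B(4)[folded D_def] D0 _ Db0]) (use B(1) in auto)
  have card: "card ?B = CARD('t) - 1" using B(1,3) by simp
  have pb0: "\<tau> \<bullet> b0 = 0" using \<tau>(1) by (simp add: b0_def inner_commute)
  have sum_D: "(\<Sum>b\<in>?B. D b) = trace C"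
    using trace_orthonormal_basis[OF B(2,3), of C] B(1) Db0 orthonormal_finite[OF B(2)]
    by (simp add: D_def[symmetric] sum_diff)
  have "\<tau> \<bullet> \<tau> = (\<Sum>b\<in>B. (\<tau> \<bullet> b)\<^sup>2)"
    using orthonormal_parseval[OF B(2), of \<tau> \<tau>] B(3) by (simp add: power2_eq_square)
  also have "\<dots> = (\<Sum>b\<in>?B. (\<tau> \<bullet> b)\<^sup>2)"
    using B(1) pb0 orthonormal_finite[OF B(2)] by (simp add: sum_diff)
  finally have sum_p: "(\<Sum>b\<in>?B. p b) = 1"
    using \<tau>(2) unfolding p_def sum_divide_distrib[symmetric] by (metis divide_self inner_eq_zero_iff)
  have "\<tau> \<bullet> (C *v \<tau>) = (\<Sum>b\<in>B. D b * (\<tau> \<bullet> b)\<^sup>2)"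
  proof -
    have "(C *v \<tau>) \<bullet> b = D b * (\<tau> \<bullet> b)" if "b \<in> B" for b
      using self_adjoint_of_symmetric[OF sym, of \<tau> b] B(4)[OF that]
      by (metis D_def inner_scaleR_right)
    then show ?thesis
      using orthonormal_parseval[OF B(2), of \<tau> "C *v \<tau>"] B(3)
      by (simp add: power2_eq_square mult_ac)
  qed
  also have "\<dots> = (\<Sum>b\<in>?B. D b * (\<tau> \<bullet> b)\<^sup>2)"
    using B(1) pb0 orthonormal_finite[OF B(2)] by (simp add: sum_diff)
  finally have sum_Dp: "(\<Sum>b\<in>?B. D b * p b) = u"
    by (simp add: p_def u_def flip: sum_divide_distrib)
  define w where "w b = \<alpha> * p b + \<beta> * (1 - p b)" for b
  have norm: "\<alpha> * \<beta> ^ (card ?B - 1) = 1" using \<alpha>\<beta>(3) by (simp add: card numeral_2_eq_2)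
  have p0: "p b \<ge> 0" for b by (simp add: p_def)
  have w: "(\<Prod>b\<in>?B. w b) \<ge> 1" "b \<in> ?B \<Longrightarrow> w b > 0" for b
    unfolding w_def using prod_affine_ge_1[OF fin p0 sum_p \<alpha>\<beta>(1,2) norm] by blast+
  \<comment> \<open>Weights with product at least 1 can only enlarge the product of the eigenvalues;
    the geometric mean of the weighted eigenvalues is then bounded by their arithmetic mean.\<close>
  have "(\<Prod>b\<in>?B. D b) \<le> (\<Prod>b\<in>?B. D b) * (\<Prod>b\<in>?B. w b)"
    using mult_left_mono[OF w(1), of "\<Prod>b\<in>?B. D b"] by (simp add: D0 prod_nonneg)
  then have "Phi_D C \<le> root (card ?B) (\<Prod>b\<in>?B. D b * w b)"
    using t by (simp add: Phi card prod.distrib)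
  also have "\<dots> \<le> (\<Sum>b\<in>?B. D b * w b) / card ?B"
  proof (rule root_arith_geom_mean[OF fin])
    show "?B \<noteq> {}" using sum_p by (metis sum.empty zero_neq_one)
    show "0 \<le> D b * w b" if "b \<in> ?B" for b using D0 w(2)[OF that] by (simp add: less_imp_le)
  qed
  also have "(\<Sum>b\<in>?B. D b * w b) = \<alpha> * u + \<beta> * (trace C - u)"
    unfolding sum_D[symmetric] sum_Dp[symmetric] w_def
    by (simp only: sum_distrib_left ring_distribs sum.distrib sum_subtractf right_diff_distrib mult_ac mult_1 mult_1_right)
  finally show ?thesis using t by (simp add: card of_nat_diff)
qed

lemma outer_mult_vec: "(\<chi> i j. w $ i * v $ j) *v x = (v \<bullet> x) *\<^sub>R (w :: real^'k)"
  by (simp add: vec_eq_iff matrix_vector_mult_def inner_vec_def sum_distrib_left sum_distrib_right mult_ac)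

text \<open>The all-ones vector has eigenvalue 0, \<open>w\<close> has \<open>a - r\<close>, and the
  complement of both has \<open>a\<close> with multiplicity \<open>t - 2\<close>. Information
  matrices of pseudo symmetric designs have this shape.\<close>

lemma Phi_D_rank_one_perturbation:
  fixes w :: "real^'t"
  assumes t: "CARD('t) \<ge> 2" and w: "ones_vec \<bullet> w = 0" "w \<noteq> 0" and r: "a \<ge> 0" "r \<le> a"
  shows "Phi_D (a *\<^sub>R B_mat - (r / (w \<bullet> w)) *\<^sub>R (\<chi> i j. w $ i * w $ j))
       = root (CARD('t) - 1) ((a - r) * a ^ (CARD('t) - 2))"
proof -
  define C where "C = a *\<^sub>R B_mat - (r / (w \<bullet> w)) *\<^sub>R (\<chi> i j. w $ i * w $ j)"
  have Cx: "C *v x = a *\<^sub>R (x - (ones_vec \<bullet> x / real CARD('t)) *\<^sub>R ones_vec) - (r * (w \<bullet> x) / (w \<bullet> w)) *\<^sub>R w" for x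
    by (simp add: C_def matrix_vector_mult_diff_rdistrib B_mat_mult_vec outer_mult_vec
        flip: scaleR_matrix_vector_assoc)
  have sym: "x \<bullet> (C *v y) = (C *v x) \<bullet> y" for x y
    by (simp add: Cx inner_diff_left inner_diff_right inner_commute[of x ones_vec] inner_commute[of x w] mult_ac)
  define b0 where "b0 = (1 / sqrt (real CARD('t))) *\<^sub>R (ones_vec :: real^'t)"
  define b1 where "b1 = (1 / norm w) *\<^sub>R w"
  have A0: "orthonormal {b0}" by (simp add: orthonormal_def b0_def norm_ones_vec)
  have A1: "norm b1 = 1" using w(2) by (simp add: b1_def)
  have b10: "b1 \<bullet> b0 = 0" using w(1) by (simp add: b1_def b0_def inner_commute)
  note A = orthonormal_insert[OF A0 A1, simplified, OF b10]
  have oo: "ones_vec \<bullet> (ones_vec :: real^'t) = real CARD('t)"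
    by (simp add: ones_vec_inner) (simp add: ones_vec_def)
  have C0: "C *v b0 = 0"
    using w(1) by (simp add: Cx b0_def oo inner_commute[of w ones_vec])
  have C1: "C *v b1 = (a - r) *\<^sub>R b1"
    using w by (simp add: Cx b1_def diff_divide_distrib scaleR_left_diff_distrib)
  obtain B where B: "{b1, b0} \<subseteq> B" "orthonormal B" "card B = CARD('t)"
      "\<And>b. b \<in> B \<Longrightarrow> C *v b = (b \<bullet> (C *v b)) *\<^sub>R b"
  proof (rule extend_orthonormal_eigenbasis[of "(*v) C", OF _ sym A(1)])
    fix b assume "b \<in> {b1, b0}"
    then show "C *v b = (b \<bullet> (C *v b)) *\<^sub>R b" 
      using A1 by (auto simp: C0 C1 dot_square_norm)
  qed auto
  define D where "D b = (if b = b0 then 0 else if b = b1 then a - r else a)" for b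
  have perp: "C *v b = a *\<^sub>R b" if "b \<in> B" "b \<noteq> b0" "b \<noteq> b1" for b
  proof -
    have "b0 \<bullet> b = 0" "b1 \<bullet> b = 0" using B(1) that by (auto simp: orthonormal_inner[OF B(2)])
    then have "ones_vec \<bullet> b = 0" "w \<bullet> b = 0" using w(2) by (auto simp: b0_def b1_def)
    then show ?thesis by (simp add: Cx)
  qed
  have ne: "b1 \<noteq> b0" using A(2) by simp
  have "Phi_D C = root (CARD('t) - 1) (\<Prod>b\<in>B - {b0}. D b)"
  proof (rule Phi_D_orthonormal_eigenbasis[OF B(2,3)])
    show "C *v b = D b *\<^sub>R b" if "b \<in> B" for b using that perp C0 C1 by (auto simp: D_def)
  qed (use B(1) r in \<open>auto simp: D_def\<close>)
  also have "(\<Prod>b\<in>B - {b0}. D b) = D b1 * (\<Prod>b\<in>B - {b0} - {b1}. D b)"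
    using B(1) ne orthonormal_finite[OF B(2)] by (intro prod.remove) auto
  also have "(\<Prod>b\<in>B - {b0} - {b1}. D b) = (\<Prod>b\<in>B - {b0} - {b1}. a)"
    by (intro prod.cong) (auto simp: D_def)
  also have "\<dots> = a ^ (CARD('t) - 2)"
    using B(1,3) ne orthonormal_finite[OF B(2)] by (simp add: numeral_2_eq_2)
  finally show ?thesis using ne by (simp add: C_def D_def)
qed

section \<open>Centring, \<open>B_tilde\<close> and exchangeable priors\<close>

lemma transpose_B_mat: "transpose B_mat = (B_mat :: real^'k^'k)"
  by (simp add: B_mat_def J_mat_def transpose_def mat_def vec_eq_iff eq_commute)

lemma B_mat_ones_vec: "B_mat *v ones_vec = (0 :: real^'k)"
proof -
  have "ones_vec \<bullet> (ones_vec :: real^'k) = real CARD('k)"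
    by (simp add: ones_vec_inner) (simp add: ones_vec_def)
  then show ?thesis by (simp add: B_mat_mult_vec)
qed

lemma ones_vec_inner_B_mat: "ones_vec \<bullet> (B_mat *v x) = 0"
  by (simp add: self_adjoint_of_symmetric[OF transpose_B_mat] B_mat_ones_vec)

lemma B_mat_mult_vec_id: "ones_vec \<bullet> x = 0 \<Longrightarrow> B_mat *v x = x"
  by (simp add: B_mat_mult_vec)

lemma trace_scaleR: "trace (a *\<^sub>R A) = a * trace (A :: real^'k^'k)"
  by (simp add: trace_def sum_distrib_left)

lemma row_sum_of_ones_vec: "A *v ones_vec = 0 \<Longrightarrow> (\<Sum>j\<in>UNIV. A $ i $ j) = (0::real)"
  by (simp add: vec_eq_iff matrix_vector_mult_def ones_vec_def)

text \<open>Transpositions equalise the diagonal entries, and the off-diagonal entries within each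
  row. Zero row sums then express the latter through the former, so the trace determines the
  matrix.\<close>

lemma permutation_invariant_matrix:
  fixes A :: "real^'t^'t"
  assumes t: "CARD('t) \<ge> 2" and A1: "A *v ones_vec = 0"
    and inv: "\<And>\<pi> i j. bij \<pi> \<Longrightarrow> A $ \<pi> i $ \<pi> j = A $ i $ j"
  shows "A = (trace A / (real CARD('t) - 1)) *\<^sub>R B_mat"
proof -
  let ?s = "Transposition.transpose :: 't \<Rightarrow> _"
  fix i0 :: 't
  define a where "a = A $ i0 $ i0"
  have diag: "A $ i $ i = a" for i
    using inv[of "?s i0 i" i0 i0] by (simp add: a_def)
  have off: "(real CARD('t) - 1) * A $ i $ j = - a" if "i \<noteq> j" for i j
  proof -
    have "A $ i $ k = A $ i $ j" if "k \<noteq> i" for k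
      using inv[of "?s j k" i j] that \<open>i \<noteq> j\<close> by simp
    then have "(\<Sum>k\<in>UNIV. A $ i $ k) = (\<Sum>k\<in>UNIV. if k = i then a else A $ i $ j)"
      by (intro sum.cong) (auto simp: diag)
    also have "\<dots> = a + (real CARD('t) - 1) * A $ i $ j"
      using t by (subst sum.remove[of _ i]) (simp_all add: of_nat_diff)
    finally show ?thesis using row_sum_of_ones_vec[OF A1, of i] by simp
  qed
  have "trace A = real CARD('t) * a" by (simp add: trace_def diag)
  moreover have "A $ i $ j = a * real CARD('t) / (real CARD('t) - 1) * B_mat $ i $ j" for i j
  proof (cases "i = j")
    case False
    with off[of i j] t show ?thesis by (simp add: B_mat_def mat_def J_mat_def field_simps)
  qed (use t in \<open>simp add: diag B_mat_def mat_def J_mat_def field_simps\<close>)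
  ultimately show ?thesis by (simp add: vec_eq_iff mult.commute)
qed

lemma completely_symmetric_zero_row_sums:
  fixes A :: "real^'t^'t"
  assumes t: "CARD('t) \<ge> 2" and "A *v ones_vec = 0" "completely_symmetric A"
  shows "A = (trace A / (real CARD('t) - 1)) *\<^sub>R B_mat"
proof (rule permutation_invariant_matrix[OF t assms(2)])
  fix \<pi> :: "'t \<Rightarrow> 't" and i j assume "bij \<pi>"
  then show "A $ \<pi> i $ \<pi> j = A $ i $ j"
    using assms(3) by (auto simp: completely_symmetric_def mat_def J_mat_def bij_def inj_eq)
qed

section \<open>The quadratic form of \<open>B_tilde\<close>\<close>

text \<open>Positivity makes \<Sigma> injective and hence invertible. The form of the inverse at
  \<open>x\<close> is the form of \<Sigma> at the preimage of \<open>x\<close>.\<close>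

lemma pos_definite_matrix_inv:
  assumes "pos_definite \<Sigma>"
  shows "x \<noteq> 0 \<Longrightarrow> x \<bullet> (matrix_inv \<Sigma> *v x) > 0" "transpose (matrix_inv \<Sigma>) = matrix_inv \<Sigma>"
proof -
  have sym: "transpose \<Sigma> = \<Sigma>" and pos: "\<And>x. x \<noteq> 0 \<Longrightarrow> x \<bullet> (\<Sigma> *v x) > 0"
    using assms by (auto simp: pos_definite_def)
  have "\<forall>x. \<Sigma> *v x = 0 \<longrightarrow> x = 0" using pos by (metis inner_zero_right less_irrefl)
  then have "\<exists>A'. A' ** \<Sigma> = mat 1" by (simp add: matrix_left_invertible_ker)
  then have "\<exists>A'. \<Sigma> ** A' = mat 1 \<and> A' ** \<Sigma> = mat 1" by (metis matrix_left_right_inverse)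
  then have M: "\<Sigma> ** matrix_inv \<Sigma> = mat 1" "matrix_inv \<Sigma> ** \<Sigma> = mat 1"
    unfolding matrix_inv_def by (rule someI2_ex, simp)+
  have Mv: "\<Sigma> *v (matrix_inv \<Sigma> *v x) = x" for x
    by (simp add: matrix_vector_mul_assoc M)
  show "x \<bullet> (matrix_inv \<Sigma> *v x) > 0" if "x \<noteq> 0"
  proof -
    have "matrix_inv \<Sigma> *v x \<noteq> 0" using that Mv[of x] by auto
    from pos[OF this] show ?thesis by (simp add: Mv inner_commute)
  qed
  have "transpose (matrix_inv \<Sigma>) ** \<Sigma> = mat 1"
    using arg_cong[OF M(1), of transpose] by (simp add: matrix_transpose_mul sym transpose_mat)
  then have "transpose (matrix_inv \<Sigma>) ** \<Sigma> ** matrix_inv \<Sigma> = matrix_inv \<Sigma>" by simp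
  then show "transpose (matrix_inv \<Sigma>) = matrix_inv \<Sigma>"
    by (simp add: M flip: matrix_mul_assoc)
qed

lemma B_tilde_inner:
  fixes \<Sigma> :: "real^'p^'p"
  assumes "pos_definite \<Sigma>"
  defines "M \<equiv> matrix_inv \<Sigma>"
  shows "x \<bullet> (B_tilde \<Sigma> *v y)
       = x \<bullet> (M *v y) - (ones_vec \<bullet> (M *v x)) * (ones_vec \<bullet> (M *v y)) / (ones_vec \<bullet> (M *v ones_vec))"
proof -
  have "J_mat *v z = (ones_vec \<bullet> z) *\<^sub>R (ones_vec :: real^'p)" for z
    by (simp add: vec_eq_iff matrix_vector_mult_def J_mat_def ones_vec_inner) (simp add: ones_vec_def)
  then have "(M ** J_mat ** M) *v y = (ones_vec \<bullet> (M *v y)) *\<^sub>R (M *v ones_vec)"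
    by (simp add: matrix_vector_mult_scaleR flip: matrix_vector_mul_assoc)
  moreover have "x \<bullet> (M *v ones_vec) = ones_vec \<bullet> (M *v x)"
    by (metis M_def assms(1) inner_commute pos_definite_matrix_inv(2) self_adjoint_of_symmetric)
  ultimately show ?thesis
    by (simp add: B_tilde_def M_def[symmetric] matrix_vector_mult_diff_rdistrib inner_diff_right mult.commute
        flip: scaleR_matrix_vector_assoc)
qed

lemma B_tilde_symmetric:
  assumes "pos_definite \<Sigma>"
  shows "x \<bullet> (B_tilde \<Sigma> *v y) = y \<bullet> (B_tilde \<Sigma> *v x)"
  using self_adjoint_of_symmetric[OF pos_definite_matrix_inv(2)[OF assms], of x y]
  by (simp add: B_tilde_inner[OF assms] inner_commute mult.commute)

text \<open>The form of \<open>B_tilde\<close> at \<open>x\<close> is the form of the inverse of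
  \<Sigma> at the component \<open>y\<close> of \<open>x\<close> that is orthogonal to the all-ones
  vector with respect to that inverse. Hence it is nonnegative and vanishes only if \<open>y\<close>
  does.\<close>

lemma B_tilde_psd:
  fixes x :: "real^'p"
  assumes "pos_definite \<Sigma>"
  shows "x \<bullet> (B_tilde \<Sigma> *v x) \<ge> 0"
    and "x \<bullet> (B_tilde \<Sigma> *v x) = 0 \<Longrightarrow> \<exists>c. x = c *\<^sub>R ones_vec"
proof -
  define M where "M = matrix_inv \<Sigma>"
  have pos: "\<And>x. x \<noteq> 0 \<Longrightarrow> x \<bullet> (M *v x) > 0"
    using pos_definite_matrix_inv(1)[OF assms] by (simp add: M_def)
  have swap: "x \<bullet> (M *v ones_vec) = ones_vec \<bullet> (M *v x)"
    by (metis M_def assms(1) inner_commute pos_definite_matrix_inv(2) self_adjoint_of_symmetric)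
  define k where "k = ones_vec \<bullet> (M *v (ones_vec :: real^'p))"
  have "(ones_vec :: real^'p) \<noteq> 0" by (simp add: ones_vec_def vec_eq_iff)
  then have k: "k > 0" unfolding k_def by (rule pos)
  define c where "c = ones_vec \<bullet> (M *v x) / k"
  define y where "y = x - c *\<^sub>R ones_vec"
  have "y \<bullet> (M *v y) = x \<bullet> (M *v x) - 2 * c * (ones_vec \<bullet> (M *v x)) + c\<^sup>2 * k"
    by (simp add: y_def k_def inner_diff_left inner_diff_right matrix_vector_mult_diff_distrib
        matrix_vector_mult_scaleR swap power2_eq_square algebra_simps)
  also have "\<dots> = x \<bullet> (B_tilde \<Sigma> *v x)"
    using k by (simp add: B_tilde_inner[OF assms] M_def[symmetric] k_def[symmetric] c_def
        power2_eq_square field_simps)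
  finally have eq: "x \<bullet> (B_tilde \<Sigma> *v x) = y \<bullet> (M *v y)" by simp
  show "x \<bullet> (B_tilde \<Sigma> *v x) \<ge> 0" unfolding eq using pos[of y] by (cases "y = 0") auto
  assume "x \<bullet> (B_tilde \<Sigma> *v x) = 0"
  then have "y = 0" using pos[of y] unfolding eq by (cases "y = 0") auto
  then show "\<exists>c. x = c *\<^sub>R ones_vec" unfolding y_def by auto
qed

lemma inner_matrix_mult_vec: "x \<bullet> (A *v y) = (\<Sum>i\<in>UNIV. \<Sum>j\<in>UNIV. A $ i $ j * (x $ i * (y $ j :: real)))"
  by (simp add: inner_vec_def matrix_vector_mult_def sum_distrib_left mult_ac)

section \<open>Expected Rayleigh quotients under exchangeable priors\<close>

text \<open>The Rayleigh quotient pairs \<open>A\<close> entrywise with the normalised outer product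
  of \<tau> with itself. The expectation \<open>M\<close> of the latter is permutation invariant by
  exchangeability and has zero row sums and trace 1, so it is \<open>B_mat\<close> divided by
  \<open>t - 1\<close>.\<close>

lemma exchangeable_expectation_rayleigh:
  fixes g :: "(real^'t) measure" and A :: "real^'t^'t"
  assumes t: "CARD('t) \<ge> 2" and g: "is_prior g" "exchangeable g" and A1: "A *v ones_vec = 0"
  shows "integrable g (\<lambda>\<tau>. \<tau> \<bullet> (A *v \<tau>) / (\<tau> \<bullet> \<tau>))"
    and "(LINT \<tau>|g. \<tau> \<bullet> (A *v \<tau>) / (\<tau> \<bullet> \<tau>)) = trace A / (real CARD('t) - 1)"
proof -
  interpret prob_space g using g(1) by (simp add: is_prior_def)
  have sets: "sets g = sets borel" and ae: "AE \<tau> in g. ones_vec \<bullet> \<tau> = 0 \<and> \<tau> \<noteq> 0"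
    using g(1) by (simp_all add: is_prior_def)
  define h where "h i j \<tau> = \<tau> $ i * \<tau> $ j / (\<tau> \<bullet> \<tau>)" for i j and \<tau> :: "real^'t"
  have h_borel: "h i j \<in> borel_measurable borel" for i j
    unfolding h_def by measurable
  then have h_meas: "h i j \<in> borel_measurable g" for i j
    using measurable_cong_sets[OF sets refl] by blast
  \<comment> \<open>Normalisation bounds the entries by 1, which gives integrability under any
    prior. At \<tau> = 0 division by zero yields 0, so the bound holds everywhere.\<close>
  have h_le: "norm (h i j \<tau>) \<le> 1" for i j \<tau>
  proof (cases "\<tau> = 0")
    case False
    have "\<bar>\<tau> $ i\<bar> * \<bar>\<tau> $ j\<bar> \<le> norm \<tau> * norm \<tau>"
      by (intro mult_mono component_le_norm_cart) auto
    then show ?thesis using False by (simp add: h_def abs_mult dot_square_norm power2_eq_square)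
  qed (simp add: h_def)
  have h_int: "integrable g (h i j)" for i j
    by (intro integrable_const_bound[of _ 1] AE_I2 h_le h_meas)
  have expand: "\<tau> \<bullet> (A *v \<tau>) / (\<tau> \<bullet> \<tau>) = (\<Sum>i\<in>UNIV. \<Sum>j\<in>UNIV. A $ i $ j * h i j \<tau>)" for \<tau>
    by (simp add: inner_matrix_mult_vec h_def sum_divide_distrib)
  show "integrable g (\<lambda>\<tau>. \<tau> \<bullet> (A *v \<tau>) / (\<tau> \<bullet> \<tau>))"
    unfolding expand by (intro Bochner_Integration.integrable_sum integrable_mult_right h_int)
  define M :: "real^'t^'t" where "M = (\<chi> i j. LINT \<tau>|g. h i j \<tau>)"
  have inv: "M $ \<pi> i $ \<pi> j = M $ i $ j" if "bij \<pi>" for \<pi> i j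
  proof -
    define P :: "real^'t \<Rightarrow> real^'t" where "P \<tau> = (\<chi> i. \<tau> $ \<pi> i)" for \<tau>
    have "P \<in> borel_measurable borel"
      unfolding P_def by (intro borel_measurable_continuous_onI continuous_intros)
    then have P: "P \<in> measurable g borel" using measurable_cong_sets[OF sets refl] by blast
    have "P \<tau> \<bullet> P \<tau> = \<tau> \<bullet> \<tau>" for \<tau>
      using sum.reindex_bij_betw[OF that, of "\<lambda>i. \<tau> $ i * \<tau> $ i"] by (simp add: inner_vec_def P_def)
    then have hP: "h i j (P \<tau>) = h (\<pi> i) (\<pi> j) \<tau>" for \<tau> by (simp add: h_def P_def)
    have "\<pi> permutes UNIV" using bij_imp_permutes[OF that] by simp
    then have "distr g borel P = g" using g(2) by (simp add: exchangeable_def P_def[abs_def])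
    then have "(LINT \<tau>|g. h i j \<tau>) = (LINT \<tau>|distr g borel P. h i j \<tau>)" by simp
    also have "\<dots> = (LINT \<tau>|g. h (\<pi> i) (\<pi> j) \<tau>)"
      by (subst integral_distr[OF P h_borel]) (simp add: hP)
    finally show ?thesis by (simp add: M_def)
  qed
  have M1: "M *v ones_vec = 0"
  proof -
    have "(\<Sum>j\<in>UNIV. (LINT \<tau>|g. h i j \<tau>)) = 0" for i
    proof -
      have "(\<Sum>j\<in>UNIV. (LINT \<tau>|g. h i j \<tau>)) = (LINT \<tau>|g. (\<Sum>j\<in>UNIV. h i j \<tau>))"
        by (subst Bochner_Integration.integral_sum) (simp_all add: h_int)
      also have "\<dots> = (LINT \<tau>|g. 0)"
      proof (rule integral_cong_AE)
        show "AE \<tau> in g. (\<Sum>j\<in>UNIV. h i j \<tau>) = 0" using ae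
          by eventually_elim (simp add: h_def ones_vec_inner flip: sum_divide_distrib sum_distrib_left)
      qed (intro borel_measurable_sum h_meas, simp)
      finally show ?thesis by simp
    qed
    then show ?thesis by (simp add: vec_eq_iff matrix_vector_mult_def ones_vec_def M_def)
  qed
  have trM: "trace M = 1"
  proof -
    have "trace M = (LINT \<tau>|g. (\<Sum>i\<in>UNIV. h i i \<tau>))"
      unfolding trace_def M_def by (subst Bochner_Integration.integral_sum) (simp_all add: h_int)
    also have "\<dots> = (LINT \<tau>|g. 1)"
    proof (rule integral_cong_AE)
      show "AE \<tau> in g. (\<Sum>j\<in>UNIV. h j j \<tau>) = 1" using ae
      proof eventually_elim
        case (elim \<tau>)
        have "(\<Sum>j\<in>UNIV. h j j \<tau>) = (\<tau> \<bullet> \<tau>) / (\<tau> \<bullet> \<tau>)"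
          unfolding h_def sum_divide_distrib[symmetric] by (simp add: inner_vec_def)
        then show ?case using elim by simp
      qed
    qed (intro borel_measurable_sum h_meas, simp)
    finally show ?thesis by (simp add: prob_space)
  qed
  have M: "M = (1 / (real CARD('t) - 1)) *\<^sub>R B_mat"
    using permutation_invariant_matrix[OF t M1 inv] by (simp add: trM)
  have "(LINT \<tau>|g. \<tau> \<bullet> (A *v \<tau>) / (\<tau> \<bullet> \<tau>)) = (\<Sum>i\<in>UNIV. \<Sum>j\<in>UNIV. A $ i $ j * M $ i $ j)"
    unfolding expand by (simp add: Bochner_Integration.integral_sum h_int M_def)
  also have "\<dots> = (\<Sum>i\<in>UNIV. \<Sum>j\<in>UNIV. A $ i $ j * ((if i = j then 1 else 0) - 1 / real CARD('t))) / (real CARD('t) - 1)"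
    by (simp add: M B_mat_def mat_def J_mat_def sum_divide_distrib)
  \<comment> \<open>The constant part of \<open>B_mat\<close> only meets the row sums of
    \<open>A\<close>, which are 0.\<close>
  also have "\<dots> = (\<Sum>i\<in>UNIV. A $ i $ i - (\<Sum>j\<in>UNIV. A $ i $ j) / real CARD('t)) / (real CARD('t) - 1)"
  proof -
    have "A $ i $ j * ((if i = j then 1 else 0) - 1 / real CARD('t))
        = (if j = i then A $ i $ i else 0) - A $ i $ j / real CARD('t)" for i j
      by (auto simp: right_diff_distrib)
    then show ?thesis by (simp add: sum_subtractf sum_divide_distrib)
  qed
  also have "\<dots> = trace A / (real CARD('t) - 1)"
    by (simp add: row_sum_of_ones_vec[OF A1] trace_def)
  finally show "(LINT \<tau>|g. \<tau> \<bullet> (A *v \<tau>) / (\<tau> \<bullet> \<tau>)) = trace A / (real CARD('t) - 1)" .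
qed

section \<open>Information matrices\<close>

lemma sum_matrix_vector_mult: "(\<Sum>s\<in>S. A s) *v x = (\<Sum>s\<in>S. A s *v (x :: real^'k))"
  by (induction S rule: infinite_finite_induct) (simp_all add: matrix_vector_mult_add_rdistrib)

lemma matrix_vector_mult_sum: "A *v (\<Sum>s\<in>S. x s) = (\<Sum>s\<in>S. A *v (x s :: real^'k))"
  by (induction S rule: infinite_finite_induct) (simp_all add: matrix_vector_right_distrib)

lemma inner_transpose_mult:
  "x \<bullet> (transpose A *v y) = (A *v x) \<bullet> (y :: real^'k)"
  "x \<bullet> (y v* A) = (A *v x) \<bullet> (y :: real^'k)"
  by (metis dot_lmul_matrix inner_commute vector_transpose_matrix transpose_transpose)+

lemma matrix_eq_inner:
  fixes A B :: "real^'k^'m"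
  assumes "\<And>z w. z \<bullet> (A *v w) = z \<bullet> (B *v w)"
  shows "A = B"
proof -
  have "A *v w = B *v w" for w
    using vector_eq_ldot[of "A *v w" "B *v w"] assms by auto
  then show ?thesis by (intro matrix_eq[THEN iffD2] allI)
qed

lemma trace_inner_axis: "trace A = (\<Sum>k\<in>UNIV. axis k 1 \<bullet> (A *v axis k (1::real)))"
  by (simp add: trace_def inner_axis' matrix_vector_mult_basis column_def del: inner_axis)

text \<open>In an orthonormal basis containing the normalised \<tau>, the trace is a sum of
  nonnegative terms, one of which is the Rayleigh quotient.\<close>

lemma trace_ge_rayleigh:
  fixes A :: "real^'k^'k"
  assumes psd: "\<And>x. 0 \<le> x \<bullet> (A *v x)" and "\<tau> \<noteq> 0"
  shows "\<tau> \<bullet> (A *v \<tau>) / (\<tau> \<bullet> \<tau>) \<le> trace A"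
proof -
  define b where "b = (1 / norm \<tau>) *\<^sub>R \<tau>"
  have "norm b = 1" using assms(2) by (simp add: b_def)
  then obtain B where B: "b \<in> B" "pairwise orthogonal B" "\<And>x. x \<in> B \<Longrightarrow> norm x = 1"
      "card B = DIM(real^'k)"
    using vector_in_orthonormal_basis by metis
  then have o: "orthonormal B" by (simp add: orthonormal_def)
  have "\<tau> \<bullet> (A *v \<tau>) / (\<tau> \<bullet> \<tau>) = b \<bullet> (A *v b)"
    by (simp add: b_def matrix_vector_mult_scaleR dot_square_norm power2_eq_square)
  also have "\<dots> \<le> (\<Sum>b\<in>B. b \<bullet> (A *v b))"
    using B(1) psd orthonormal_finite[OF o] by (intro member_le_sum) auto
  also have "\<dots> = trace A" using trace_orthonormal_basis[OF o] B(4) by simp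
  finally show ?thesis .
qed

section \<open>Information matrices as Gram matrices\<close>

definition centered_G :: "nat \<Rightarrow> ('p::{finite,linorder} \<Rightarrow> 't::finite) \<Rightarrow> ('p, 't) rmat" where
  "centered_G i s = G_mat i s ** B_mat"

lemma centered_G_ones_vec: "centered_G i s *v ones_vec = 0"
  unfolding centered_G_def matrix_vector_mul_assoc[symmetric] B_mat_ones_vec
  by (rule matrix_vector_mult_0_right)

lemma G_d_eq: "G_d i e = (\<Sum>s\<in>UNIV. e s *\<^sub>R centered_G i s)"
  by (simp add: G_d_def centered_G_def)

lemma G_d_mult_vec: "G_d i e *v x = (\<Sum>s\<in>UNIV. e s *\<^sub>R (centered_G i s *v x))"
  by (simp add: G_d_eq sum_matrix_vector_mult flip: scaleR_matrix_vector_assoc)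

lemma Chat_s_inner:
  "z \<bullet> (Chat_s \<Sigma> i j s *v w) = (centered_G i s *v z) \<bullet> (B_tilde \<Sigma> *v (centered_G j s *v w))"
proof -
  have "z \<bullet> (Chat_s \<Sigma> i j s *v w)
      = z \<bullet> (B_mat *v (transpose (G_mat i s) *v (B_tilde \<Sigma> *v (centered_G j s *v w))))"
    by (simp only: Chat_s_def centered_G_def matrix_vector_mul_assoc matrix_mul_assoc)
  also have "\<dots> = (G_mat i s *v (B_mat *v z)) \<bullet> (B_tilde \<Sigma> *v (centered_G j s *v w))"
    by (simp only: self_adjoint_of_symmetric[OF transpose_B_mat] inner_transpose_mult(1))
  finally show ?thesis by (simp only: centered_G_def matrix_vector_mul_assoc)
qed

text \<open>A covariance in its uncentred form, mean of products minus product of means, with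
  products taken with respect to \<open>B_tilde\<close>. The centred form follows in
  \<open>C_d_inner\<close>.\<close>

lemma C_d_inner_eq:
  "z \<bullet> (C_d \<Sigma> n i j e *v w)
   = n * ((\<Sum>s\<in>UNIV. e s * ((centered_G i s *v z) \<bullet> (B_tilde \<Sigma> *v (centered_G j s *v w))))
        - (G_d i e *v z) \<bullet> (B_tilde \<Sigma> *v (G_d j e *v w)))"
  unfolding C_d_def Chat_d_def
  by (simp add: matrix_vector_mult_diff_rdistrib sum_matrix_vector_mult inner_diff_right inner_sum_right
      inner_transpose_mult Chat_s_inner right_diff_distrib
      flip: scaleR_matrix_vector_assoc matrix_vector_mul_assoc)

lemma C_d_ones_vec: "C_d \<Sigma> n i j e *v ones_vec = 0"
proof -
  have "z \<bullet> (C_d \<Sigma> n i j e *v ones_vec) = 0" for z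
    by (simp add: C_d_inner_eq G_d_mult_vec centered_G_ones_vec)
  then show ?thesis by (metis inner_eq_zero_iff)
qed

definition deviation :: "nat \<Rightarrow> ('p::{finite,linorder}, 't::finite) design \<Rightarrow> ('p \<Rightarrow> 't) \<Rightarrow> ('p, 't) rmat" where
  "deviation i e s = centered_G i s - G_d i e"

text \<open>The information matrices are Gram matrices of weighted deviations from the mean; all
  positivity properties come from this.\<close>

lemma C_d_inner:
  fixes e :: "('p::{finite,linorder}, 't::finite) design"
  assumes "is_design e"
  shows "z \<bullet> (C_d \<Sigma> n i j e *v w)
   = n * (\<Sum>s\<in>UNIV. e s * ((deviation i e s *v z) \<bullet> (B_tilde \<Sigma> *v (deviation j e s *v w))))"
proof -
  define a where "a s = centered_G i s *v z" for s :: "'p \<Rightarrow> 't"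
  define b where "b s = B_tilde \<Sigma> *v (centered_G j s *v w)" for s :: "'p \<Rightarrow> 't"
  define a' where "a' = (\<Sum>s\<in>UNIV. e s *\<^sub>R a s)"
  define b' where "b' = (\<Sum>s\<in>UNIV. e s *\<^sub>R b s)"
  have sum: "(\<Sum>s\<in>UNIV. e s) = 1" using assms by (simp add: is_design_def)
  have G: "G_d i e *v z = a'" "B_tilde \<Sigma> *v (G_d j e *v w) = b'"
    by (simp_all add: G_d_mult_vec a'_def b'_def a_def b_def matrix_vector_mult_sum matrix_vector_mult_scaleR)
  have "(\<Sum>s\<in>UNIV. e s * ((a s - a') \<bullet> (b s - b')))
      = (\<Sum>s\<in>UNIV. e s * (a s \<bullet> b s)) - (\<Sum>s\<in>UNIV. e s *\<^sub>R a s) \<bullet> b' - a' \<bullet> (\<Sum>s\<in>UNIV. e s *\<^sub>R b s)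
        + (\<Sum>s\<in>UNIV. e s) * (a' \<bullet> b')"
    by (simp add: inner_diff_left inner_diff_right algebra_simps sum.distrib sum_subtractf
        inner_sum_left inner_sum_right sum_distrib_left sum_distrib_right)
  also have "\<dots> = (\<Sum>s\<in>UNIV. e s * (a s \<bullet> b s)) - a' \<bullet> b'"
    by (simp add: sum flip: a'_def b'_def)
  finally show ?thesis
    by (simp add: C_d_inner_eq deviation_def matrix_vector_mult_diff_rdistrib matrix_vector_mult_diff_distrib
        G flip: a_def b_def)
qed

lemma transpose_C_d:
  assumes "pos_definite \<Sigma>"
  shows "transpose (C_d \<Sigma> n i j e) = C_d \<Sigma> n j i e"
proof (rule matrix_eq_inner)
  show "z \<bullet> (transpose (C_d \<Sigma> n i j e) *v w) = z \<bullet> (C_d \<Sigma> n j i e *v w)" for z w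
    unfolding inner_transpose_mult inner_commute[of "C_d \<Sigma> n i j e *v z"] C_d_inner_eq
    by (simp add: B_tilde_symmetric[OF assms, of "centered_G i s *v w" for s]
        B_tilde_symmetric[OF assms, of "G_d i e *v w"])
qed

text \<open>The direct deviation at \<open>z\<close> and the carryover deviation at \<open>w\<close>
  are added before the form of \<open>B_tilde\<close> is applied. This positivity of the whole two
  by two block matrix is what controls the subtracted term of the information matrix.\<close>

lemma C_d_joint_psd:
  assumes "pos_definite \<Sigma>" "is_design e"
  shows "z \<bullet> (C_d \<Sigma> n 1 1 e *v z) + 2 * (z \<bullet> (C_d \<Sigma> n 1 2 e *v w)) + w \<bullet> (C_d \<Sigma> n 2 2 e *v w) \<ge> 0"
proof -
  let ?v = "\<lambda>s. deviation 1 e s *v z + deviation 2 e s *v w"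
  have "0 \<le> n * (\<Sum>s\<in>UNIV. e s * (?v s \<bullet> (B_tilde \<Sigma> *v ?v s)))"
    using assms(2) by (intro mult_nonneg_nonneg sum_nonneg B_tilde_psd(1)[OF assms(1)])
      (auto simp: is_design_def)
  also have "\<dots> = z \<bullet> (C_d \<Sigma> n 1 1 e *v z) + 2 * (z \<bullet> (C_d \<Sigma> n 1 2 e *v w)) + w \<bullet> (C_d \<Sigma> n 2 2 e *v w)"
    by (simp add: C_d_inner[OF assms(2)] inner_add_left inner_add_right matrix_vector_right_distrib
        B_tilde_symmetric[OF assms(1), of "deviation 2 e s *v w" "deviation 1 e s *v z" for s]
        sum.distrib sum_distrib_left algebra_simps del: One_nat_def)
  finally show ?thesis .
qed

lemma c_s_eq:
  "c_s \<Sigma> i j s = (\<Sum>k\<in>UNIV. (centered_G i s *v axis k 1) \<bullet> (B_tilde \<Sigma> *v (centered_G j s *v axis k 1)))"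
  by (simp add: c_s_def trace_inner_axis Chat_s_inner)

text \<open>A sum of \<open>B_tilde\<close> forms at the columns of one matrix depending on
  \<open>x\<close>; expanding the square, with \<open>B_tilde\<close> symmetric, gives the three
  coefficients. Nonnegativity and the analysis of zeros rest on this form.\<close>

lemma q_s_eq:
  assumes "pos_definite \<Sigma>"
  shows "q_s \<Sigma> s x = (\<Sum>k\<in>UNIV. ((centered_G 1 s + x *\<^sub>R centered_G 2 s) *v axis k 1) \<bullet>
           (B_tilde \<Sigma> *v ((centered_G 1 s + x *\<^sub>R centered_G 2 s) *v axis k 1)))"
  by (simp add: q_s_def c_s_eq matrix_vector_mult_add_rdistrib inner_add_left inner_add_right
      matrix_vector_right_distrib matrix_vector_mult_scaleR sum.distrib sum_distrib_left power2_eq_square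
      B_tilde_symmetric[OF assms, of "centered_G 2 s *v axis k 1" "centered_G 1 s *v axis k 1" for k]
      algebra_simps del: One_nat_def flip: scaleR_matrix_vector_assoc)

lemma q_s_nonneg: "pos_definite \<Sigma> \<Longrightarrow> q_s \<Sigma> s x \<ge> 0"
  unfolding q_s_eq by (intro sum_nonneg B_tilde_psd(1))

lemma q_d_nonneg: "pos_definite \<Sigma> \<Longrightarrow> is_design e \<Longrightarrow> q_d \<Sigma> e x \<ge> 0"
  unfolding q_d_def by (intro sum_nonneg mult_nonneg_nonneg q_s_nonneg) (auto simp: is_design_def)

section \<open>Comparison of \<open>info_matrix\<close> with
  \<open>known_lambda_info\<close>\<close>

text \<open>The matrix \<open>K(x)\<close> of the introduction; \<open>info_matrix\<close> subtracts
  from it the cost of estimating the carryover proportion.\<close>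

definition known_lambda_info ::
    "('p, 'p) rmat \<Rightarrow> nat \<Rightarrow> ('p::{finite,linorder}, 't::finite) design \<Rightarrow> real \<Rightarrow> ('t, 't) rmat" where
  "known_lambda_info \<Sigma> n e x =
     C_d \<Sigma> n 1 1 e + x *\<^sub>R (C_d \<Sigma> n 1 2 e + C_d \<Sigma> n 2 1 e) + x\<^sup>2 *\<^sub>R C_d \<Sigma> n 2 2 e"

lemma known_lambda_info_ones_vec: "known_lambda_info \<Sigma> n e x *v ones_vec = 0"
  by (simp add: known_lambda_info_def matrix_vector_mult_add_rdistrib C_d_ones_vec
      flip: scaleR_matrix_vector_assoc)

lemma transpose_add_scaleR:
  "transpose (A + B) = transpose A + (transpose B :: real^'k^'k)"
  "transpose (A - B) = transpose A - (transpose B :: real^'k^'k)"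
  "transpose (c *\<^sub>R A) = c *\<^sub>R (transpose A :: real^'k^'k)"
  by (simp_all add: transpose_def vec_eq_iff)

lemma transpose_known_lambda_info:
  "pos_definite \<Sigma> \<Longrightarrow> transpose (known_lambda_info \<Sigma> n e x) = known_lambda_info \<Sigma> n e x"
  by (simp add: known_lambda_info_def transpose_add_scaleR transpose_C_d add.commute)

lemma C_d_inner_swap:
  "pos_definite \<Sigma> \<Longrightarrow> z \<bullet> (C_d \<Sigma> n i j e *v w) = w \<bullet> (C_d \<Sigma> n j i e *v z)"
  by (metis inner_commute inner_transpose_mult transpose_C_d)

text \<open>The joint form at \<open>z\<close> and \<open>x *\<^sub>R z + y *\<^sub>R \<tau>\<close>
  is a quadratic in \<open>y\<close>, nonnegative by \<open>C_d_joint_psd\<close>. For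
  \<open>z\<close> equal to \<tau> it is the form of the matrix at \<open>x + y\<close>.\<close>

lemma known_lambda_info_shift:
  fixes e :: "('p::{finite,linorder}, 't::finite) design" and \<tau> z :: "real^'t"
    and x y :: real and n :: nat
  assumes "pos_definite \<Sigma>" "is_design e"
  defines "b \<equiv> \<lambda>z. z \<bullet> ((C_d \<Sigma> n 1 2 e + x *\<^sub>R C_d \<Sigma> n 2 2 e) *v \<tau>)"
    and "c \<equiv> \<tau> \<bullet> (C_d \<Sigma> n 2 2 e *v \<tau>)"
  shows "z \<bullet> (known_lambda_info \<Sigma> n e x *v z) + 2 * y * b z + y\<^sup>2 * c \<ge> 0"
    and "\<tau> \<bullet> (known_lambda_info \<Sigma> n e (x + y) *v \<tau>)
       = \<tau> \<bullet> (known_lambda_info \<Sigma> n e x *v \<tau>) + 2 * y * b \<tau> + y\<^sup>2 * c"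
proof -
  have K: "z \<bullet> (known_lambda_info \<Sigma> n e x *v z)
     = z \<bullet> (C_d \<Sigma> n 1 1 e *v z) + 2 * x * (z \<bullet> (C_d \<Sigma> n 1 2 e *v z)) + x\<^sup>2 * (z \<bullet> (C_d \<Sigma> n 2 2 e *v z))" for z x
    by (simp add: known_lambda_info_def matrix_vector_mult_add_rdistrib inner_add_right
        C_d_inner_swap[OF assms(1), of z n 2 1 e z] del: One_nat_def flip: scaleR_matrix_vector_assoc)
  have b: "b z = z \<bullet> (C_d \<Sigma> n 1 2 e *v \<tau>) + x * (z \<bullet> (C_d \<Sigma> n 2 2 e *v \<tau>))" for z
    by (simp add: b_def matrix_vector_mult_add_rdistrib inner_add_right flip: scaleR_matrix_vector_assoc)
  show "z \<bullet> (known_lambda_info \<Sigma> n e x *v z) + 2 * y * b z + y\<^sup>2 * c \<ge> 0"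
    using C_d_joint_psd[OF assms(1,2), of z n "x *\<^sub>R z + y *\<^sub>R \<tau>"]
    by (simp add: K b c_def matrix_vector_right_distrib matrix_vector_mult_scaleR inner_add_left
        inner_add_right C_d_inner_swap[OF assms(1), of \<tau> n 2 2 e z] power2_eq_square algebra_simps)
  show "\<tau> \<bullet> (known_lambda_info \<Sigma> n e (x + y) *v \<tau>)
       = \<tau> \<bullet> (known_lambda_info \<Sigma> n e x *v \<tau>) + 2 * y * b \<tau> + y\<^sup>2 * c"
    by (simp add: K b c_def power2_eq_square algebra_simps)
qed

text \<open>The deficit is \<open>n\<close> times a sum of \<open>B_tilde\<close> forms at the
  columns of \<open>G_d 1 e + x *\<^sub>R G_d 2 e\<close>, which is nonnegative.\<close>

lemma trace_known_lambda_info_le: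
  assumes "pos_definite \<Sigma>" "is_design e"
  shows "trace (known_lambda_info \<Sigma> n e x) \<le> n * q_d \<Sigma> e x"
proof -
  let ?G = "\<lambda>i k. G_d i e *v axis k 1"
  define m where "m i j = (\<Sum>k\<in>UNIV. ?G i k \<bullet> (B_tilde \<Sigma> *v ?G j k))" for i j
  have tr: "trace (C_d \<Sigma> n i j e) = n * ((\<Sum>s\<in>UNIV. e s * c_s \<Sigma> i j s) - m i j)" for i j
    unfolding trace_inner_axis C_d_inner_eq c_s_eq m_def
    by (simp add: sum_distrib_left right_diff_distrib sum_subtractf) (rule sum.swap)
  have sym: "c_s \<Sigma> 2 1 s = c_s \<Sigma> 1 2 s" for s
    unfolding c_s_eq by (intro sum.cong refl B_tilde_symmetric assms)
  have sym': "m 2 1 = m 1 2" unfolding m_def by (intro sum.cong refl B_tilde_symmetric assms)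
  have "0 \<le> (\<Sum>k\<in>UNIV. (?G 1 k + x *\<^sub>R ?G 2 k) \<bullet> (B_tilde \<Sigma> *v (?G 1 k + x *\<^sub>R ?G 2 k)))"
    by (intro sum_nonneg B_tilde_psd(1) assms)
  also have "\<dots> = m 1 1 + x * (m 1 2 + m 2 1) + x\<^sup>2 * m 2 2"
    by (simp add: m_def inner_add_left inner_add_right matrix_vector_right_distrib matrix_vector_mult_scaleR
        sum.distrib sum_distrib_left power2_eq_square algebra_simps)
  finally have "real n * (m 1 1 + x * (m 1 2 + m 2 1) + x\<^sup>2 * m 2 2) \<ge> 0" by simp
  moreover have "trace (known_lambda_info \<Sigma> n e x)
      = n * q_d \<Sigma> e x - n * (m 1 1 + x * (m 1 2 + m 2 1) + x\<^sup>2 * m 2 2)"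
    by (simp add: known_lambda_info_def trace_add trace_scaleR tr q_d_def q_s_def sym sym' sum.distrib
        sum_distrib_left algebra_simps del: One_nat_def)
  ultimately show ?thesis by simp
qed

lemma info_matrix_alt:
  fixes e :: "('p::{finite,linorder}, 't::finite) design" and \<tau> :: "real^'t" and lam :: real and n :: nat
  assumes "pos_definite \<Sigma>"
  defines "u \<equiv> (C_d \<Sigma> n 1 2 e + lam *\<^sub>R C_d \<Sigma> n 2 2 e) *v \<tau>"
    and "c \<equiv> \<tau> \<bullet> (C_d \<Sigma> n 2 2 e *v \<tau>)"
  shows "info_matrix \<Sigma> n \<tau> lam e
       = known_lambda_info \<Sigma> n e lam - (if c = 0 then 0 else 1 / c) *\<^sub>R (\<chi> i j. u $ i * u $ j)"
proof -
  have "\<tau> v* (C_d \<Sigma> n 2 1 e + lam *\<^sub>R C_d \<Sigma> n 2 2 e)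
      = transpose (C_d \<Sigma> n 2 1 e + lam *\<^sub>R C_d \<Sigma> n 2 2 e) *v \<tau>"
    by (simp add: vector_transpose_matrix)
  also have "\<dots> = u"
    by (simp add: transpose_add_scaleR transpose_C_d[OF assms(1)] u_def del: transpose_matrix_vector)
  finally show ?thesis
    unfolding info_matrix_def Let_def u_def[symmetric] c_def[symmetric] known_lambda_info_def by simp
qed

lemma info_matrix_inner:
  fixes e :: "('p::{finite,linorder}, 't::finite) design" and \<tau> z :: "real^'t"
  assumes "pos_definite \<Sigma>"
  shows "z \<bullet> (info_matrix \<Sigma> n \<tau> lam e *v z) = z \<bullet> (known_lambda_info \<Sigma> n e lam *v z)
      - (if \<tau> \<bullet> (C_d \<Sigma> n 2 2 e *v \<tau>) = 0 then 0
         else (z \<bullet> ((C_d \<Sigma> n 1 2 e + lam *\<^sub>R C_d \<Sigma> n 2 2 e) *v \<tau>))\<^sup>2 / (\<tau> \<bullet> (C_d \<Sigma> n 2 2 e *v \<tau>)))"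
  unfolding info_matrix_alt[OF assms] matrix_vector_mult_diff_rdistrib scaleR_matrix_vector_assoc[symmetric]
    outer_mult_vec inner_diff_right
  by (simp add: power2_eq_square inner_commute del: One_nat_def)

text \<open>For \<open>c\<close> nonzero, the form of \<open>I\<close> at \<open>z\<close> is the
  minimum over \<open>y\<close> of the quadratic in \<open>known_lambda_info_shift\<close>. This
  gives nonnegativity and, at \<tau>, the bound by \<open>K x\<close> for every \<open>x\<close>.
  The degenerate case \<open>c = 0\<close> is handled separately.\<close>

lemma info_matrix_facts:
  fixes e :: "('p::{finite,linorder}, 't::finite) design" and \<tau> :: "real^'t" and lam :: real and n :: nat
  assumes S: "pos_definite \<Sigma>" and e: "is_design e"
  defines "I \<equiv> info_matrix \<Sigma> n \<tau> lam e"
  shows "transpose I = I" "I *v ones_vec = 0" "0 \<le> z \<bullet> (I *v z)"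
    "z \<bullet> (I *v z) \<le> z \<bullet> (known_lambda_info \<Sigma> n e lam *v z)"
    "\<tau> \<bullet> (I *v \<tau>) \<le> \<tau> \<bullet> (known_lambda_info \<Sigma> n e x *v \<tau>)"
proof -
  define u where "u = (C_d \<Sigma> n 1 2 e + lam *\<^sub>R C_d \<Sigma> n 2 2 e) *v \<tau>"
  define c where "c = \<tau> \<bullet> (C_d \<Sigma> n 2 2 e *v \<tau>)"
  define K where "K = known_lambda_info \<Sigma> n e"
  note alt = info_matrix_alt[OF S, of n \<tau> lam e, folded u_def c_def K_def I_def]
  note inner = info_matrix_inner[OF S, of _ n \<tau> lam e, folded u_def c_def K_def I_def]
  note shift = known_lambda_info_shift[OF S e, where n = n and x = lam and \<tau> = \<tau>, folded u_def c_def K_def]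
  show "transpose I = I"
    using transpose_known_lambda_info[OF S, of n e lam]
    by (simp add: alt transpose_add_scaleR K_def) (simp add: transpose_def mult.commute)
  have "ones_vec \<bullet> u = 0"
    unfolding u_def matrix_vector_mult_add_rdistrib scaleR_matrix_vector_assoc[symmetric]
      inner_add_right inner_scaleR_right C_d_inner_swap[OF S, of ones_vec]
    by (simp add: C_d_ones_vec)
  then have "u \<bullet> ones_vec = 0" by (simp add: inner_commute)
  then show "I *v ones_vec = 0"
    unfolding alt matrix_vector_mult_diff_rdistrib scaleR_matrix_vector_assoc[symmetric] outer_mult_vec
    by (simp add: K_def known_lambda_info_ones_vec)
  have c: "c \<ge> 0"
    using C_d_joint_psd[OF S e, of 0 n \<tau>] by (simp add: c_def)
  show "0 \<le> z \<bullet> (I *v z)" for z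
  proof (cases "c = 0")
    case True
    then show ?thesis using shift(1)[of z 0] by (simp add: inner)
  next
    case False
    \<comment> \<open>The substituted value is the minimiser of the quadratic in
      \<open>y\<close>.\<close>
    then show ?thesis using shift(1)[of z "- (z \<bullet> u) / c"]
      by (simp add: inner power2_eq_square field_simps)
  qed
  show "z \<bullet> (I *v z) \<le> z \<bullet> (known_lambda_info \<Sigma> n e lam *v z)" for z
    using c by (simp add: inner flip: K_def)
  have "\<tau> \<bullet> (I *v \<tau>) \<le> \<tau> \<bullet> (K (lam + y) *v \<tau>)" for y
  proof (cases "c = 0")
    case True
    \<comment> \<open>With \<open>c = 0\<close> the nonnegative quadratic in \<open>y\<close> is
      affine, so its slope must vanish; otherwise the value substituted below would make it equal to
      -1.\<close>
    have "\<tau> \<bullet> u = 0"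
    proof (rule ccontr)
      assume "\<tau> \<bullet> u \<noteq> 0"
      then show False
        using shift(1)[of \<tau> "- (\<tau> \<bullet> (K lam *v \<tau>) + 1) / (2 * (\<tau> \<bullet> u))"] True by (simp add: field_simps)
    qed
    then show ?thesis using True by (simp add: inner shift(2))
  next
    case False
    have "2 * y * (\<tau> \<bullet> u) + y\<^sup>2 * c + (\<tau> \<bullet> u)\<^sup>2 / c = (\<tau> \<bullet> u + y * c)\<^sup>2 / c"
      using False by (simp add: power2_eq_square field_simps)
    moreover have "\<dots> \<ge> 0" using c by simp
    ultimately show ?thesis using False by (simp add: inner shift(2))
  qed
  from this[of "x - lam"] show "\<tau> \<bullet> (I *v \<tau>) \<le> \<tau> \<bullet> (known_lambda_info \<Sigma> n e x *v \<tau>)"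
    by (simp add: K_def)
qed

section \<open>Upper bound for the criterion of an arbitrary design\<close>

text \<open>\<open>Phi_D_le\<close> separates the direction of \<tau> from the rest of the trace.
  Along \<tau> the bound by \<open>K x\<close> with free \<open>x\<close> is used, on the rest the
  bound by \<open>K lam\<close>.\<close>

lemma Phi_D_info_matrix_le:
  fixes e :: "('p::{finite,linorder}, 't::finite) design" and \<tau> :: "real^'t" and n :: nat
  assumes t: "CARD('t) \<ge> 2" and S: "pos_definite \<Sigma>" and e: "is_design e"
    and \<tau>: "ones_vec \<bullet> \<tau> = 0" "\<tau> \<noteq> 0"
    and \<alpha>\<beta>: "\<alpha> > 0" "\<beta> > 0" "\<alpha> * \<beta> ^ (CARD('t) - 2) = 1"
  defines "K \<equiv> known_lambda_info \<Sigma> n e"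
  shows "Phi_D (info_matrix \<Sigma> n \<tau> lam e)
       \<le> (\<alpha> * (\<tau> \<bullet> (K x *v \<tau>) / (\<tau> \<bullet> \<tau>)) + \<beta> * (trace (K lam) - \<tau> \<bullet> (K lam *v \<tau>) / (\<tau> \<bullet> \<tau>)))
         / (real CARD('t) - 1)"
proof -
  define I where "I = info_matrix \<Sigma> n \<tau> lam e"
  note facts = info_matrix_facts[OF S e, where n = n and \<tau> = \<tau> and lam = lam, folded I_def K_def]
  have "Phi_D I \<le> (\<alpha> * (\<tau> \<bullet> (I *v \<tau>) / (\<tau> \<bullet> \<tau>)) + \<beta> * (trace I - \<tau> \<bullet> (I *v \<tau>) / (\<tau> \<bullet> \<tau>)))
      / (real CARD('t) - 1)"
    by (rule Phi_D_le[OF t facts(1,3,2) \<tau> \<alpha>\<beta>])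
  also have "\<dots> \<le> (\<alpha> * (\<tau> \<bullet> (K x *v \<tau>) / (\<tau> \<bullet> \<tau>)) + \<beta> * (trace (K lam) - \<tau> \<bullet> (K lam *v \<tau>) / (\<tau> \<bullet> \<tau>)))
      / (real CARD('t) - 1)"
  proof (intro divide_right_mono add_mono mult_left_mono)
    show "\<tau> \<bullet> (I *v \<tau>) \<le> \<tau> \<bullet> (K x *v \<tau>)" by (rule facts)
    \<comment> \<open>The difference is nonnegative definite, so its Rayleigh quotient is at most
      its trace; rearranged, this compares the two remainders of the trace.\<close>
    have "\<tau> \<bullet> ((K lam - I) *v \<tau>) / (\<tau> \<bullet> \<tau>) \<le> trace (K lam - I)"
      using facts(4) by (intro trace_ge_rayleigh \<tau>(2)) (simp add: matrix_vector_mult_diff_rdistrib inner_diff_right)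
    then show "trace I - \<tau> \<bullet> (I *v \<tau>) / (\<tau> \<bullet> \<tau>) \<le> trace (K lam) - \<tau> \<bullet> (K lam *v \<tau>) / (\<tau> \<bullet> \<tau>)"
      by (simp add: matrix_vector_mult_diff_rdistrib inner_diff_right trace_sub diff_divide_distrib)
  qed (use t \<alpha>\<beta> in auto)
  finally show ?thesis by (simp add: I_def)
qed

text \<open>Integrating the pointwise bound replaces each Rayleigh quotient by a trace divided by
  \<open>t - 1\<close>. The parameters \<open>x\<close>, \<alpha> and \<beta> stay free, to be
  fitted later to a candidate design.\<close>

lemma D_criterion_le:
  fixes e :: "('p::{finite,linorder}, 't::finite) design" and g :: "(real^'t) measure"
  assumes t: "CARD('t) \<ge> 2" and S: "pos_definite \<Sigma>" and e: "is_design e"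
    and g: "is_prior g" "exchangeable g"
    and \<alpha>\<beta>: "\<alpha> > 0" "\<beta> > 0" "\<alpha> * \<beta> ^ (CARD('t) - 2) = 1"
  shows "D_criterion \<Sigma> n g lam e
       \<le> n / (real CARD('t) - 1) *
         (1 / (real CARD('t) - 1) * (\<alpha> * q_d \<Sigma> e x) + (real CARD('t) - 2) / (real CARD('t) - 1) * (\<beta> * q_d \<Sigma> e lam))"
    (is "_ \<le> ?R")
proof -
  interpret prob_space g using g(1) by (simp add: is_prior_def)
  have ae: "AE \<tau> in g. ones_vec \<bullet> \<tau> = 0 \<and> \<tau> \<noteq> 0" using g(1) by (simp add: is_prior_def)
  define m where "m = real CARD('t) - 1"
  have m: "m \<ge> 1" using t by (simp add: m_def)
  define K where "K = known_lambda_info \<Sigma> n e"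
  define h where "h x \<tau> = \<tau> \<bullet> (K x *v \<tau>) / (\<tau> \<bullet> \<tau>)" for x \<tau>
  have K1: "K x *v ones_vec = 0" for x by (simp add: K_def known_lambda_info_ones_vec)
  note h = exchangeable_expectation_rayleigh[OF t g K1, folded h_def m_def]
  have trK: "trace (K x) \<le> n * q_d \<Sigma> e x" for x
    unfolding K_def by (rule trace_known_lambda_info_le[OF S e])
  define f where "f \<tau> = Phi_D (info_matrix \<Sigma> n \<tau> lam e)" for \<tau>
  define F where "F \<tau> = (\<alpha> * h x \<tau> + \<beta> * (trace (K lam) - h lam \<tau>)) / m" for \<tau>
  show ?thesis
  proof (cases "integrable g f")
    case True
    have F: "integrable g F" unfolding F_def by (simp add: h(1))
    have "D_criterion \<Sigma> n g lam e = (LINT \<tau>|g. f \<tau>)" by (simp add: D_criterion_def f_def)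
    also have "\<dots> \<le> (LINT \<tau>|g. F \<tau>)"
    proof (rule integral_mono_AE[OF True F])
      show "AE \<tau> in g. f \<tau> \<le> F \<tau>" using ae
      proof eventually_elim
        case (elim \<tau>)
        then show ?case unfolding f_def F_def h_def m_def K_def
          by (intro Phi_D_info_matrix_le[OF t S e _ _ \<alpha>\<beta>]) auto
      qed
    qed
    also have "\<dots> = (\<alpha> * (trace (K x) / m) + \<beta> * (trace (K lam) - trace (K lam) / m)) / m"
      unfolding F_def by (simp add: h prob_space)
    also have "\<dots> = (\<alpha> * trace (K x) + \<beta> * (m - 1) * trace (K lam)) / m\<^sup>2"
      using m by (simp add: power2_eq_square field_simps)
    also have "\<dots> \<le> (\<alpha> * (n * q_d \<Sigma> e x) + \<beta> * (m - 1) * (n * q_d \<Sigma> e lam)) / m\<^sup>2"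
      using trK \<alpha>\<beta> m by (intro divide_right_mono add_mono mult_left_mono) auto
    also have "\<dots> = n / m * (1 / m * (\<alpha> * q_d \<Sigma> e x) + (m - 1) / m * (\<beta> * q_d \<Sigma> e lam))"
      using m by (simp add: power2_eq_square field_simps)
    also have "\<dots> = ?R" by (simp add: m_def)
    finally show ?thesis .
  next
    case False
    \<comment> \<open>The integral of a function that is not integrable is 0 by convention, and the
      bound is nonnegative.\<close>
    then have "D_criterion \<Sigma> n g lam e = 0"
      by (simp add: D_criterion_def f_def[abs_def] not_integrable_integral_eq)
    also have "0 \<le> ?R"
      using t \<alpha>\<beta> q_d_nonneg[OF S e] by (intro mult_nonneg_nonneg add_nonneg_nonneg) auto
    finally show ?thesis .
  qed
qed

section \<open>Pseudo symmetric designs\<close>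

lemma B_mat_nth: "B_mat $ i $ j = (if i = j then 1 else 0) - 1 / real CARD('k)" for i j :: "'k::finite"
  by (simp add: B_mat_def mat_def J_mat_def)

lemma precedes_unique: "precedes l k \<Longrightarrow> precedes l' k \<Longrightarrow> l = l'" for k :: "'p::linorder"
  by (metis precedes_def linorder_neqE)

lemma first_two_periods:
  assumes "CARD('p) \<ge> 2"
  obtains k0 k1 :: "'p::{finite,linorder}" where "\<And>l. \<not> precedes l k0" "precedes k0 k1"
proof -
  define k0 :: 'p where "k0 = Min UNIV"
  have k0: "k0 \<le> l" for l by (simp add: k0_def)
  have "UNIV - {k0} \<noteq> {}"
  proof
    assume "UNIV - {k0} = {}"
    then have "card (UNIV :: 'p set) = card {k0}" by (metis Diff_eq_empty_iff UNIV_I subset_antisym subsetI)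
    with assms show False by simp
  qed
  define k1 where "k1 = Min (UNIV - {k0})"
  have k1: "k1 \<in> UNIV - {k0}" "\<And>l. l \<noteq> k0 \<Longrightarrow> k1 \<le> l"
    using Min_in[of "UNIV - {k0}"] \<open>UNIV - {k0} \<noteq> {}\<close> by (auto simp: k1_def)
  have "precedes k0 k1"
    unfolding precedes_def using k0[of k1] k1 by (metis DiffD2 insertI1 leD le_neq_trans less_irrefl)
  moreover have "\<not> precedes l k0" for l using k0[of l] by (auto simp: precedes_def)
  ultimately show ?thesis using that by blast
qed

lemma F_mat_preceded: "precedes l k \<Longrightarrow> F_mat s $ k $ i = (if s l = i then 1 else 0)"
  using precedes_unique by (fastforce simp: F_mat_def)

lemma F_mat_first: "(\<And>l. \<not> precedes l k) \<Longrightarrow> F_mat s $ k $ i = 0"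
  by (simp add: F_mat_def)

lemma centered_G_axis_nth: "(centered_G i s *v axis j 1) $ k = (\<Sum>l\<in>UNIV. G_mat i s $ k $ l * B_mat $ l $ j)"
  by (simp add: centered_G_def matrix_vector_mult_basis column_def matrix_mult_nth)

lemma centered_T_axis_nth: "(centered_G 1 s *v axis j 1) $ k = B_mat $ s k $ j"
  by (simp add: centered_G_axis_nth G_mat_def T_mat_def mult_if_delta cong: if_cong del: One_nat_def)

lemma centered_F_axis_nth:
  "precedes l k \<Longrightarrow> (centered_G 2 s *v axis j 1) $ k = B_mat $ s l $ j"
  "(\<And>l. \<not> precedes l k) \<Longrightarrow> (centered_G 2 s *v axis j 1) $ k = 0"
  by (simp_all add: centered_G_axis_nth G_mat_def F_mat_preceded F_mat_first mult_if_delta cong: if_cong)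

lemma B_mat_diag_pos: "CARD('k::finite) \<ge> 2 \<Longrightarrow> B_mat $ i $ i > (0::real)" for i :: "'k::finite"
  by (simp add: B_mat_nth)

text \<open>The centred carryover column of the treatment given first is 0 in the first period and
  positive in the second. It is thus no multiple of the all-ones vector, and \<open>B_tilde\<close>
  is positive on it.\<close>

lemma c_s_22_pos:
  fixes s :: "'p::{finite,linorder} \<Rightarrow> 't::finite"
  assumes p: "CARD('p) \<ge> 2" and t: "CARD('t) \<ge> 2" and S: "pos_definite \<Sigma>"
  shows "c_s \<Sigma> 2 2 s > 0"
proof -
  obtain k0 k1 :: 'p where k: "\<And>l. \<not> precedes l k0" "precedes k0 k1"
    using first_two_periods[OF p] by metis
  let ?v = "centered_G 2 s *v axis (s k0) 1"
  have v: "?v $ k0 = 0" "?v $ k1 > 0"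
    using k B_mat_diag_pos[OF t, of "s k0"] by (simp_all add: centered_F_axis_nth)
  have "?v \<bullet> (B_tilde \<Sigma> *v ?v) \<noteq> 0"
  proof
    assume "?v \<bullet> (B_tilde \<Sigma> *v ?v) = 0"
    then obtain c where "?v = c *\<^sub>R ones_vec" using B_tilde_psd(2)[OF S] by blast
    then have "?v $ k0 = ?v $ k1" by (simp add: ones_vec_def)
    with v show False by simp
  qed
  then have "0 < ?v \<bullet> (B_tilde \<Sigma> *v ?v)" using B_tilde_psd(1)[OF S, of ?v] by simp
  also have "\<dots> \<le> c_s \<Sigma> 2 2 s"
    unfolding c_s_eq by (rule member_le_sum) (simp_all add: B_tilde_psd(1)[OF S])
  finally show ?thesis .
qed

text \<open>Every summand in \<open>q_s_eq\<close> vanishes, so each column is constant over the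
  periods; the conclusion equates its first two entries.\<close>

lemma q_s_eq_0_D:
  fixes s :: "'p::{finite,linorder} \<Rightarrow> 't::finite"
  assumes "pos_definite \<Sigma>" "q_s \<Sigma> s x = 0" "\<And>l. \<not> precedes l k0" "precedes k0 k1"
  shows "B_mat $ s k0 $ j = B_mat $ s k1 $ j + x * B_mat $ s k0 $ j"
proof -
  let ?v = "(centered_G 1 s + x *\<^sub>R centered_G 2 s) *v axis j 1"
  have "?v \<bullet> (B_tilde \<Sigma> *v ?v) = 0"
    using assms(2) unfolding q_s_eq[OF assms(1)]
    by (subst (asm) sum_nonneg_eq_0_iff) (simp_all add: B_tilde_psd(1)[OF assms(1)])
  then obtain c where "?v = c *\<^sub>R ones_vec" using B_tilde_psd(2)[OF assms(1)] by blast
  then have "?v $ k0 = ?v $ k1" by (simp add: ones_vec_def)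
  then show ?thesis using assms(3,4)
    by (simp add: matrix_vector_mult_add_rdistrib centered_T_axis_nth centered_F_axis_nth
        del: One_nat_def flip: scaleR_matrix_vector_assoc)
qed

text \<open>If all quadratics vanished at \<open>x\<close>, a constant sequence would force
  \<open>x = 0\<close>, and a sequence with different treatments in the first two periods would then
  equate a diagonal and an off-diagonal entry of \<open>B_mat\<close>.\<close>

lemma ex_q_s_pos:
  fixes \<Sigma> :: "('p::{finite,linorder}, 'p) rmat"
  assumes p: "CARD('p) \<ge> 2" and t: "CARD('t::finite) \<ge> 2" and S: "pos_definite \<Sigma>"
  shows "\<exists>s :: 'p \<Rightarrow> 't. q_s \<Sigma> s x > 0"
proof (rule ccontr)
  assume neg: "\<not> ?thesis"
  have q0: "q_s \<Sigma> s x = 0" for s :: "'p \<Rightarrow> 't" 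
  proof -
    have "\<not> 0 < q_s \<Sigma> s x" using neg by blast
    then show ?thesis using q_s_nonneg[OF S, of s x] by simp
  qed
  obtain k0 k1 :: 'p where k: "\<And>l. \<not> precedes l k0" "precedes k0 k1"
    using first_two_periods[OF p] by metis
  have ne: "k0 \<noteq> k1" using k by blast
  obtain i i' :: 't where i: "i \<noteq> i'"
    using t card_le_Suc0_iff_eq[of "UNIV :: 't set"] by auto
  have B: "B_mat $ i $ i > (0::real)" by (rule B_mat_diag_pos[OF t])
  have "B_mat $ i $ i = B_mat $ i $ i + x * B_mat $ i $ i"
    using q_s_eq_0_D[OF S q0 k, of "\<lambda>_. i" i] by simp
  then have x: "x = 0" using B by simp
  have "B_mat $ i $ i = B_mat $ i' $ i + x * B_mat $ i $ i"
    using q_s_eq_0_D[OF S q0 k, of "\<lambda>k. if k = k0 then i else i'" i] ne by simp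
  then show False using i by (simp add: x B_mat_nth)
qed

definition c_mean :: "('p, 'p) rmat \<Rightarrow> nat \<Rightarrow> nat \<Rightarrow> ('p::{finite,linorder}, 't::finite) design \<Rightarrow> real" where
  "c_mean \<Sigma> i j e = (\<Sum>s\<in>UNIV. e s * c_s \<Sigma> i j s)"

lemma q_d_eq: "q_d \<Sigma> e x = c_mean \<Sigma> 1 1 e + 2 * c_mean \<Sigma> 1 2 e * x + c_mean \<Sigma> 2 2 e * x\<^sup>2"
  by (simp add: q_d_def q_s_def c_mean_def sum.distrib sum_distrib_left sum_distrib_right algebra_simps
      del: One_nat_def)

lemma c_d_eq: "c_d \<Sigma> n i j e = n * c_mean \<Sigma> i j e"
  by (simp add: c_d_def c_mean_def)

lemma c_mean_22_pos:
  fixes e :: "('p::{finite,linorder}, 't::finite) design"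
  assumes "CARD('p) \<ge> 2" "CARD('t) \<ge> 2" "pos_definite \<Sigma>" "is_design e"
  shows "c_mean \<Sigma> 2 2 e > 0"
proof -
  have e: "\<And>s. e s \<ge> 0" "(\<Sum>s\<in>UNIV. e s) = 1" using assms(4) by (auto simp: is_design_def)
  have "\<exists>s. e s \<noteq> 0" using e(2) by (metis sum.neutral zero_neq_one)
  then obtain s where "e s > 0" using e(1) by (metis less_eq_real_def)
  then have "e s * c_s \<Sigma> 2 2 s > 0" using c_s_22_pos[OF assms(1-3)] by simp
  also have "e s * c_s \<Sigma> 2 2 s \<le> c_mean \<Sigma> 2 2 e"
    unfolding c_mean_def using e(1) c_s_22_pos[OF assms(1-3)]
    by (intro member_le_sum) (auto simp: less_imp_le)
  finally show ?thesis .
qed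

text \<open>The leading coefficient of \<open>q_d\<close> is positive, so completing the square
  identifies \<open>x_d\<close> as its minimiser.\<close>

lemma q_d_x_d:
  fixes e :: "('p::{finite,linorder}, 't::finite) design"
  assumes "CARD('p) \<ge> 2" "CARD('t) \<ge> 2" "pos_definite \<Sigma>" "is_design e" "n \<ge> 1"
  shows "x_d \<Sigma> n e = - c_mean \<Sigma> 1 2 e / c_mean \<Sigma> 2 2 e"
    and "q_d \<Sigma> e (x_d \<Sigma> n e) = c_mean \<Sigma> 1 1 e - (c_mean \<Sigma> 1 2 e)\<^sup>2 / c_mean \<Sigma> 2 2 e"
    and "q_d \<Sigma> e (x_d \<Sigma> n e) \<le> q_d \<Sigma> e x"
proof -
  note pos = c_mean_22_pos[OF assms(1-4)]
  show x: "x_d \<Sigma> n e = - c_mean \<Sigma> 1 2 e / c_mean \<Sigma> 2 2 e"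
    using assms(5) by (simp add: x_d_def c_d_eq)
  show q: "q_d \<Sigma> e (x_d \<Sigma> n e) = c_mean \<Sigma> 1 1 e - (c_mean \<Sigma> 1 2 e)\<^sup>2 / c_mean \<Sigma> 2 2 e"
    unfolding x q_d_eq using pos by (simp add: power2_eq_square field_simps)
  have "q_d \<Sigma> e x - q_d \<Sigma> e (x_d \<Sigma> n e)
      = (c_mean \<Sigma> 2 2 e * x + c_mean \<Sigma> 1 2 e)\<^sup>2 / c_mean \<Sigma> 2 2 e"
    unfolding q q_d_eq[of \<Sigma> e x] using pos by (simp add: power2_eq_square field_simps)
  moreover have "\<dots> \<ge> 0" using pos by simp
  ultimately show "q_d \<Sigma> e (x_d \<Sigma> n e) \<le> q_d \<Sigma> e x" by simp
qed

section \<open>Replication, complete symmetry and the exact criterion\<close>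

definition equireplicated :: "('p::{finite,linorder}, 't::finite) design \<Rightarrow> bool" where
  "equireplicated e \<longleftrightarrow> (\<forall>k i. (\<Sum>s | s k = i. e s) = 1 / real CARD('t))"

text \<open>Each row of the averaged design matrix is constant (0 in the first period of the
  carryover part), and centring by \<open>B_mat\<close> annihilates constant rows.\<close>

lemma equireplicated_G_d:
  fixes e :: "('p::{finite,linorder}, 't::finite) design"
  assumes "equireplicated e"
  shows "G_d i e = 0"
proof -
  have T: "(\<Sum>s\<in>UNIV. e s * (if s k = l then 1 else 0)) = 1 / real CARD('t)" for k l
    using assms by (simp add: equireplicated_def if_distrib sum.If_cases cong: if_cong)
  have "\<exists>c. \<forall>l. (\<Sum>s\<in>UNIV. e s * G_mat i s $ k $ l) = c" for k
  proof (cases "i = 1")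
    case True
    then show ?thesis by (simp add: G_mat_def T_mat_def T)
  next
    case False
    then show ?thesis
      by (cases "\<exists>l. precedes l k") (auto simp: G_mat_def F_mat_preceded F_mat_first T)
  qed
  then obtain c where c: "\<And>k l. (\<Sum>s\<in>UNIV. e s * G_mat i s $ k $ l) = c k" by metis
  have "G_d i e $ k $ j = 0" for k j
  proof -
    have "G_d i e $ k $ j = (\<Sum>s\<in>UNIV. \<Sum>l\<in>UNIV. e s * G_mat i s $ k $ l * B_mat $ l $ j)"
      by (simp add: G_d_def matrix_mult_nth sum_distrib_left mult_ac)
    also have "\<dots> = (\<Sum>l\<in>UNIV. \<Sum>s\<in>UNIV. e s * G_mat i s $ k $ l * B_mat $ l $ j)" by (rule sum.swap)
    also have "\<dots> = (\<Sum>l\<in>UNIV. c k * B_mat $ l $ j)"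
      by (intro sum.cong refl) (simp add: c flip: sum_distrib_right)
    also have "\<dots> = c k * (\<Sum>l\<in>UNIV. (B_mat :: real^'t^'t) $ l $ j)" by (simp add: sum_distrib_left)
    also have "(\<Sum>l\<in>UNIV. (B_mat :: real^'t^'t) $ l $ j) = 0" by (simp add: B_mat_nth sum_subtractf)
    finally show ?thesis by simp
  qed
  then show ?thesis by (simp add: vec_eq_iff)
qed

lemma equireplicated_C_d: "equireplicated e \<Longrightarrow> C_d \<Sigma> n i j e = Chat_d \<Sigma> n i j e"
  by (simp add: C_d_def equireplicated_G_d matrix_mult_nth vec_eq_iff)

lemma trace_Chat_d: "trace (Chat_d \<Sigma> n i j e) = n * c_mean \<Sigma> i j e"
proof -
  have "trace (\<Sum>s\<in>A. e s *\<^sub>R Chat_s \<Sigma> i j s) = (\<Sum>s\<in>A. e s * c_s \<Sigma> i j s)" for A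
    by (induction A rule: infinite_finite_induct) (simp_all add: trace_add trace_scaleR c_s_def trace_0[unfolded mat_0])
  then show ?thesis by (simp add: Chat_d_def trace_scaleR c_mean_def)
qed

lemma pseudo_symmetric_C_d:
  fixes e :: "('p::{finite,linorder}, 't::finite) design"
  assumes t: "CARD('t) \<ge> 2" and e: "pseudo_symmetric \<Sigma> n e" and ij: "i \<in> {1, 2}" "j \<in> {1, 2}"
  shows "C_d \<Sigma> n i j e = (n * c_mean \<Sigma> i j e / (real CARD('t) - 1)) *\<^sub>R B_mat"
proof -
  have "equireplicated e" using e by (simp add: pseudo_symmetric_def equireplicated_def)
  then have "trace (C_d \<Sigma> n i j e) = n * c_mean \<Sigma> i j e"
    by (simp add: equireplicated_C_d trace_Chat_d)
  moreover have "completely_symmetric (C_d \<Sigma> n i j e)"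
    using e ij unfolding pseudo_symmetric_def by blast
  ultimately show ?thesis
    using completely_symmetric_zero_row_sums[OF t C_d_ones_vec, of \<Sigma> n i j e] by simp
qed

lemma c_mean_swap: "pos_definite \<Sigma> \<Longrightarrow> c_mean \<Sigma> i j e = c_mean \<Sigma> j i e"
  unfolding c_mean_def c_s_eq
  by (intro sum.cong refl arg_cong2[where f = "(*)"] B_tilde_symmetric)

text \<open>All four matrices \<open>C_d\<close> are multiples of \<open>B_mat\<close>, so the
  information matrix is \<open>Q *\<^sub>R B_mat\<close> minus a rank-one term along the centred
  \<tau>. Its nontrivial eigenvalues are \<open>Q\<close>, taken \<open>t - 2\<close> times, and
  \<open>Q - r\<close>.\<close>

lemma pseudo_symmetric_Phi_D:
  fixes e :: "('p::{finite,linorder}, 't::finite) design" and \<tau> :: "real^'t"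
  assumes p: "CARD('p) \<ge> 2" and t: "CARD('t) \<ge> 2" and n: "n \<ge> 1" and S: "pos_definite \<Sigma>"
    and e: "is_design e" "pseudo_symmetric \<Sigma> n e"
    and \<tau>: "B_mat *v \<tau> \<noteq> 0"
  shows "Phi_D (info_matrix \<Sigma> n \<tau> lam e) = n / (real CARD('t) - 1) *
    root (CARD('t) - 1) (q_d \<Sigma> e (x_d \<Sigma> n e) * q_d \<Sigma> e lam ^ (CARD('t) - 2))"
proof -
  define m where "m = real CARD('t) - 1"
  have m: "m > 0" using t by (simp add: m_def)
  define a where "a i j = n * c_mean \<Sigma> i j e / m" for i j
  have C: "C_d \<Sigma> n 1 1 e = a 1 1 *\<^sub>R B_mat" "C_d \<Sigma> n 1 2 e = a 1 2 *\<^sub>R B_mat"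
    "C_d \<Sigma> n 2 1 e = a 1 2 *\<^sub>R B_mat" "C_d \<Sigma> n 2 2 e = a 2 2 *\<^sub>R B_mat"
    unfolding a_def m_def using pseudo_symmetric_C_d[OF t e(2)] c_mean_swap[OF S, of 2 1 e] by simp_all
  have a22: "a 2 2 > 0" using c_mean_22_pos[OF p t S e(1)] n m by (simp add: a_def)
  define w where "w = B_mat *v \<tau>"
  have w: "ones_vec \<bullet> w = 0" "w \<noteq> 0" using \<tau> by (simp_all add: w_def ones_vec_inner_B_mat)
  then have ww: "\<tau> \<bullet> w = w \<bullet> w"
    using self_adjoint_of_symmetric[OF transpose_B_mat, of \<tau> w] by (simp add: B_mat_mult_vec_id flip: w_def)
  define Q where "Q = a 1 1 + 2 * lam * a 1 2 + lam\<^sup>2 * a 2 2"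
  define r where "r = (a 1 2 + lam * a 2 2)\<^sup>2 / a 2 2"
  have Q: "Q = n / m * q_d \<Sigma> e lam"
    by (simp add: Q_def a_def q_d_eq algebra_simps add_divide_distrib del: One_nat_def)
  \<comment> \<open>The dependence on \<open>lam\<close> cancels; what remains is the minimum of the
    quadratic, attained at \<open>x_d\<close>.\<close>
  have "Q - r = a 1 1 - (a 1 2)\<^sup>2 / a 2 2"
    using a22 by (simp add: Q_def r_def power2_eq_square field_simps del: One_nat_def)
  also have "\<dots> = n / m * q_d \<Sigma> e (x_d \<Sigma> n e)"
    using c_mean_22_pos[OF p t S e(1)] n m
    by (simp add: q_d_x_d(2)[OF p t S e(1) n] a_def power2_eq_square field_simps del: One_nat_def)
  finally have Qr: "Q - r = n / m * q_d \<Sigma> e (x_d \<Sigma> n e)" .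
  have "(C_d \<Sigma> n 1 2 e + lam *\<^sub>R C_d \<Sigma> n 2 2 e) *v \<tau> = (a 1 2 + lam * a 2 2) *\<^sub>R w"
    unfolding C by (simp add: matrix_vector_mult_add_rdistrib scaleR_left_distrib w_def
        del: One_nat_def flip: scaleR_matrix_vector_assoc)
  moreover have "\<tau> \<bullet> (C_d \<Sigma> n 2 2 e *v \<tau>) = a 2 2 * (w \<bullet> w)"
    unfolding C by (simp add: ww flip: scaleR_matrix_vector_assoc w_def)
  moreover have "known_lambda_info \<Sigma> n e lam = Q *\<^sub>R B_mat"
    unfolding known_lambda_info_def C Q_def by (simp add: algebra_simps flip: scaleR_left_distrib del: One_nat_def)
  ultimately have "info_matrix \<Sigma> n \<tau> lam e = Q *\<^sub>R B_mat - (r / (w \<bullet> w)) *\<^sub>R (\<chi> i j. w $ i * w $ j)"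
    unfolding info_matrix_alt[OF S] using a22 w(2)
    by (simp add: vec_eq_iff r_def power2_eq_square field_simps del: One_nat_def)
  moreover have "Q \<ge> 0" using q_d_nonneg[OF S e(1)] m by (simp add: Q)
  moreover have "Q - r \<ge> 0" unfolding Qr using q_d_nonneg[OF S e(1)] m by simp
  then have "r \<le> Q" by simp
  ultimately have "Phi_D (info_matrix \<Sigma> n \<tau> lam e) = root (CARD('t) - 1) ((Q - r) * Q ^ (CARD('t) - 2))"
    using Phi_D_rank_one_perturbation[OF t w] by simp
  also have "(Q - r) * Q ^ (CARD('t) - 2)
      = (n / m) ^ (CARD('t) - 1) * (q_d \<Sigma> e (x_d \<Sigma> n e) * q_d \<Sigma> e lam ^ (CARD('t) - 2))"
  proof -
    have "CARD('t) - 1 = Suc (CARD('t) - 2)" using t by simp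
    moreover have "(Q - r) * Q ^ (CARD('t) - 2)
        = (n / m * q_d \<Sigma> e (x_d \<Sigma> n e)) * (n / m * q_d \<Sigma> e lam) ^ (CARD('t) - 2)"
      by (subst Qr) (simp only: Q)
    ultimately show ?thesis by (simp only: power_mult_distrib power_Suc mult_ac)
  qed
  also have "root (CARD('t) - 1) \<dots>
      = n / m * root (CARD('t) - 1) (q_d \<Sigma> e (x_d \<Sigma> n e) * q_d \<Sigma> e lam ^ (CARD('t) - 2))"
    using t m by (subst real_root_mult) (simp add: real_root_power_cancel)
  finally show ?thesis by (simp add: m_def)
qed

text \<open>Almost surely \<tau> is nonzero with coordinate sum 0, where the integrand has the
  constant value of \<open>pseudo_symmetric_Phi_D\<close>.\<close>

lemma pseudo_symmetric_D_criterion: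
  fixes e :: "('p::{finite,linorder}, 't::finite) design" and g :: "(real^'t) measure"
  assumes p: "CARD('p) \<ge> 2" and t: "CARD('t) \<ge> 2" and n: "n \<ge> 1" and S: "pos_definite \<Sigma>"
    and g: "is_prior g"
    and e: "is_design e" "pseudo_symmetric \<Sigma> n e"
  shows "D_criterion \<Sigma> n g lam e = n / (real CARD('t) - 1) *
    root (CARD('t) - 1) (q_d \<Sigma> e (x_d \<Sigma> n e) * q_d \<Sigma> e lam ^ (CARD('t) - 2))" (is "_ = ?R")
proof -
  interpret prob_space g using g by (simp add: is_prior_def)
  have sets: "sets g = sets borel" and ae: "AE \<tau> in g. ones_vec \<bullet> \<tau> = 0 \<and> \<tau> \<noteq> 0"
    using g by (simp_all add: is_prior_def)
  define f where "f \<tau> = Phi_D (info_matrix \<Sigma> n \<tau> lam e)" for \<tau>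
  have f: "f \<tau> = ?R" if "B_mat *v \<tau> \<noteq> 0" for \<tau>
    unfolding f_def by (rule pseudo_symmetric_Phi_D[OF p t n S e that])
  \<comment> \<open>Needed for measurability: on the closed kernel of \<open>B_mat\<close> the
    subtracted term is 0 whatever \<tau> is, so \<open>f\<close> takes at most two values, one on
    the kernel and one off it.\<close>
  have f0: "f \<tau> = f 0" if "B_mat *v \<tau> = 0" for \<tau>
  proof -
    have "C_d \<Sigma> n 1 2 e *v \<tau> = 0" "C_d \<Sigma> n 2 2 e *v \<tau> = 0"
      using pseudo_symmetric_C_d[OF t e(2)] that
      by (simp_all del: One_nat_def flip: scaleR_matrix_vector_assoc)
    then show ?thesis
      by (simp add: f_def info_matrix_alt[OF S] matrix_vector_mult_add_rdistrib
          del: One_nat_def flip: scaleR_matrix_vector_assoc)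
  qed
  have "closed {\<tau> :: real^'t. B_mat *v \<tau> = 0}"
    by (intro closed_Collect_eq continuous_intros linear_continuous_on) (simp add: linear_conv_bounded_linear[symmetric])
  then have "{\<tau> :: real^'t. B_mat *v \<tau> = 0} \<in> sets borel" by (rule borel_closed)
  then have "(\<lambda>\<tau> :: real^'t. if \<tau> \<in> {\<tau>. B_mat *v \<tau> = 0} then f 0 else ?R) \<in> borel_measurable borel"
    by (intro measurable_If_set) simp_all
  moreover have "f = (\<lambda>\<tau>. if \<tau> \<in> {\<tau>. B_mat *v \<tau> = 0} then f 0 else ?R)"
  proof
    show "f \<tau> = (if \<tau> \<in> {\<tau>. B_mat *v \<tau> = 0} then f 0 else ?R)" for \<tau>
      using f[of \<tau>] f0[of \<tau>] by (cases "B_mat *v \<tau> = 0") simp_all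
  qed
  ultimately have "f \<in> borel_measurable borel" by metis
  then have "f \<in> borel_measurable g" using measurable_cong_sets[OF sets refl] by blast
  then have "(LINT \<tau>|g. f \<tau>) = (LINT \<tau>|g. ?R)"
  proof (rule integral_cong_AE)
    show "AE \<tau> in g. f \<tau> = ?R" using ae
      by eventually_elim (intro f, simp add: B_mat_mult_vec_id)
  qed simp
  then show ?thesis by (simp add: D_criterion_def f_def prob_space)
qed

section \<open>Orbits, mixtures and optimality\<close>

lemma G_mat_permute: "bij \<pi> \<Longrightarrow> G_mat i (\<pi> \<circ> s) $ k $ \<pi> l = G_mat i s $ k $ l"
  by (auto simp: G_mat_def T_mat_def F_mat_def bij_def inj_eq)

text \<open>Relabelling permutes the columns of the design matrix, and \<open>B_mat\<close> is
  unchanged when its rows and columns are permuted together.\<close>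

lemma centered_G_permute:
  fixes \<pi> :: "'t::finite \<Rightarrow> 't"
  assumes "bij \<pi>"
  shows "centered_G i (\<pi> \<circ> s) *v axis (\<pi> a) 1 = centered_G i s *v axis a 1"
proof -
  have "(\<Sum>l\<in>UNIV. G_mat i (\<pi> \<circ> s) $ k $ l * B_mat $ l $ \<pi> a)
      = (\<Sum>l\<in>UNIV. G_mat i (\<pi> \<circ> s) $ k $ \<pi> l * B_mat $ \<pi> l $ \<pi> a)" for k
    using assms by (intro sum.reindex_bij_betw[symmetric])
  then show ?thesis
    using assms by (simp add: vec_eq_iff centered_G_axis_nth G_mat_permute B_mat_nth bij_def inj_eq)
qed

lemma c_s_permute:
  fixes \<pi> :: "'t::finite \<Rightarrow> 't"
  assumes "bij \<pi>"
  shows "c_s \<Sigma> i j (\<pi> \<circ> s) = c_s \<Sigma> i j s"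
  unfolding c_s_eq
  by (subst sum.reindex_bij_betw[OF assms, symmetric]) (simp add: centered_G_permute[OF assms])

lemma sum_sequences_permute:
  fixes \<pi> :: "'t::finite \<Rightarrow> 't" and f :: "('p::finite \<Rightarrow> 't) \<Rightarrow> 'a::comm_monoid_add"
  assumes "bij \<pi>"
  shows "(\<Sum>s\<in>UNIV. f (\<pi> \<circ> s)) = (\<Sum>s\<in>UNIV. f s)"
proof (rule sum.reindex_bij_betw)
  show "bij_betw (\<lambda>s. \<pi> \<circ> s) UNIV UNIV"
    using assms
    by (intro bij_betw_byWitness[where f' = "\<lambda>s. inv \<pi> \<circ> s"])
      (auto simp: bij_def o_assoc[symmetric] fun_eq_iff surj_f_inv_f)
qed

text \<open>A transposition of two treatments exchanges their replications in each period, so these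
  are equal. The entries of \<open>C_d\<close> are invariant under permuting both indices, and
  \<open>permutation_invariant_matrix\<close> yields complete symmetry.\<close>

lemma permutation_invariant_pseudo_symmetric:
  fixes e :: "('p::{finite,linorder}, 't::finite) design"
  assumes t: "CARD('t) \<ge> 2" and e: "is_design e" and inv: "\<And>\<pi> s. bij \<pi> \<Longrightarrow> e (\<pi> \<circ> s) = e s"
  shows "pseudo_symmetric \<Sigma> n e"
proof -
  have rep: "(\<Sum>s | s k = i. e s) = 1 / real CARD('t)" for k i
  proof -
    define r where "r i = (\<Sum>s\<in>UNIV. if s k = i then e s else 0)" for i
    have ri: "r i' = r i" for i'
    proof -
      let ?\<pi> = "Transposition.transpose i i'"
      have "?\<pi> x = i' \<longleftrightarrow> x = i" for x
        by (metis bij_def bij_transpose inj_eq transpose_apply_first)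
      then have "r i = (\<Sum>s\<in>UNIV. if (?\<pi> \<circ> s) k = i' then e (?\<pi> \<circ> s) else 0)"
        by (simp add: r_def inv cong: if_cong)
      also have "\<dots> = r i'" unfolding r_def by (rule sum_sequences_permute) simp
      finally show ?thesis by simp
    qed
    have "(\<Sum>i'\<in>UNIV. r i') = (\<Sum>i'\<in>(UNIV :: 't set). r i)"
      by (intro sum.cong refl ri)
    then have "real CARD('t) * r i = (\<Sum>i'\<in>UNIV. r i')" by simp
    also have "\<dots> = (\<Sum>s\<in>UNIV. e s)"
      unfolding r_def by (subst sum.swap) simp
    also have "\<dots> = 1" using e by (simp add: is_design_def)
    finally show ?thesis by (simp add: r_def sum.If_cases field_simps)
  qed
  then have eq: "equireplicated e" by (simp add: equireplicated_def)
  have "completely_symmetric (C_d \<Sigma> n i j e)" for i j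
  proof -
    have nth: "C_d \<Sigma> n i j e $ a $ b
      = n * (\<Sum>s\<in>UNIV. e s * ((centered_G i s *v axis a 1) \<bullet> (B_tilde \<Sigma> *v (centered_G j s *v axis b 1))))" for a b
    proof -
      have "C_d \<Sigma> n i j e $ a $ b = axis a 1 \<bullet> (C_d \<Sigma> n i j e *v axis b 1)"
        by (simp add: inner_axis' matrix_vector_mult_basis column_def)
      then show ?thesis by (simp add: C_d_inner_eq equireplicated_G_d[OF eq])
    qed
    have "C_d \<Sigma> n i j e $ \<pi> a $ \<pi> b = C_d \<Sigma> n i j e $ a $ b" if "bij \<pi>" for \<pi> a b
      unfolding nth by (subst sum_sequences_permute[OF that, symmetric]) (simp add: inv that centered_G_permute)
    then have "\<exists>c. C_d \<Sigma> n i j e = c *\<^sub>R B_mat"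
      using permutation_invariant_matrix[OF t C_d_ones_vec] by blast
    then obtain c where "C_d \<Sigma> n i j e = c *\<^sub>R mat 1 + (- (c / real CARD('t))) *\<^sub>R J_mat"
      by (auto simp: B_mat_def scaleR_right_diff_distrib)
    then show ?thesis unfolding completely_symmetric_def by blast
  qed
  then show ?thesis using rep by (simp add: pseudo_symmetric_def)
qed

definition orbit_design :: "('p \<Rightarrow> 't) \<Rightarrow> ('p::{finite,linorder}, 't::finite) design" where
  "orbit_design s = (let Orb = (\<lambda>\<pi> :: 't \<Rightarrow> 't. \<pi> \<circ> s) ` {\<pi>. bij \<pi>} in (\<lambda>s'. if s' \<in> Orb then 1 / real (card Orb) else 0))"

text \<open>All sequences of the orbit share the traces \<open>c_s\<close>. The orbit design is
  therefore an invariant substitute for the single sequence \<open>s\<close>, with the same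
  quadratic.\<close>

lemma orbit_design_facts:
  fixes s :: "'p::{finite,linorder} \<Rightarrow> 't::finite"
  shows "is_design (orbit_design s)"
    and "\<And>\<pi> :: 't \<Rightarrow> 't. bij \<pi> \<Longrightarrow> orbit_design s (\<pi> \<circ> s') = orbit_design s s'"
    and "c_mean \<Sigma> i j (orbit_design s) = c_s \<Sigma> i j s"
proof -
  define Orb where "Orb = (\<lambda>\<pi> :: 't \<Rightarrow> 't. \<pi> \<circ> s) ` {\<pi>. bij \<pi>}"
  have o: "orbit_design s = (\<lambda>s'. if s' \<in> Orb then 1 / real (card Orb) else 0)"
    unfolding orbit_design_def Orb_def Let_def ..
  have "id \<circ> s \<in> Orb" unfolding Orb_def by (rule imageI) (simp add: bij_id del: id_apply)
  then have card: "card Orb > 0" by (auto simp: card_gt_0_iff)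
  then show "is_design (orbit_design s)"
    by (auto simp: is_design_def o sum.If_cases card_gt_0_iff)
  show "orbit_design s (\<pi> \<circ> s') = orbit_design s s'" if \<pi>: "bij \<pi>" for \<pi> :: "'t \<Rightarrow> 't"
  proof -
    have "\<pi> \<circ> s' \<in> Orb \<longleftrightarrow> s' \<in> Orb"
    proof
      assume "s' \<in> Orb"
      then obtain \<sigma> where "bij \<sigma>" "s' = \<sigma> \<circ> s" by (auto simp: Orb_def)
      then show "\<pi> \<circ> s' \<in> Orb"
        using \<pi> unfolding Orb_def by (intro image_eqI[of _ _ "\<pi> \<circ> \<sigma>"]) (auto simp: bij_comp o_assoc)
    next
      assume "\<pi> \<circ> s' \<in> Orb"
      then obtain \<sigma> where \<sigma>: "bij \<sigma>" "\<pi> \<circ> s' = \<sigma> \<circ> s" by (auto simp: Orb_def)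
      have "s' = inv \<pi> \<circ> (\<pi> \<circ> s')" using \<pi> by (simp add: o_assoc bij_def)
      then have "s' = (inv \<pi> \<circ> \<sigma>) \<circ> s" by (simp add: \<sigma>(2) o_assoc)
      then show "s' \<in> Orb"
        using \<pi> \<sigma>(1) unfolding Orb_def by (intro image_eqI[of _ _ "inv \<pi> \<circ> \<sigma>"]) (auto intro: bij_comp bij_imp_bij_inv)
    qed
    then show ?thesis by (simp add: o)
  qed
  have "c_mean \<Sigma> i j (orbit_design s)
      = (\<Sum>s'\<in>UNIV. if s' \<in> Orb then 1 / real (card Orb) * c_s \<Sigma> i j s' else 0)"
    unfolding c_mean_def o by (intro sum.cong) auto
  also have "\<dots> = (\<Sum>s'\<in>Orb. 1 / real (card Orb) * c_s \<Sigma> i j s')" by (simp add: sum.If_cases)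
  also have "\<dots> = (\<Sum>s'\<in>Orb. 1 / real (card Orb) * c_s \<Sigma> i j s)"
    by (intro sum.cong refl) (auto simp: Orb_def c_s_permute)
  finally show "c_mean \<Sigma> i j (orbit_design s) = c_s \<Sigma> i j s" using card by (auto simp: card_gt_0_iff)
qed

text \<open>The term of \<open>C_d\<close> that is quadratic in the design vanishes under equal
  replication, so here \<open>C_d\<close> is linear along the segment and complete symmetry is
  inherited.\<close>

lemma pseudo_symmetric_mixture:
  fixes d e :: "('p::{finite,linorder}, 't::finite) design"
  assumes "is_design d" "is_design e" "pseudo_symmetric \<Sigma> n d" "pseudo_symmetric \<Sigma> n e" "0 \<le> r" "r \<le> 1"
  defines "f \<equiv> \<lambda>s. (1 - r) * d s + r * e s"
  shows "is_design f" "pseudo_symmetric \<Sigma> n f" "c_mean \<Sigma> i j f = (1 - r) * c_mean \<Sigma> i j d + r * c_mean \<Sigma> i j e"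
proof -
  have lin: "(\<Sum>s\<in>A. f s * h s) = (1 - r) * (\<Sum>s\<in>A. d s * h s) + r * (\<Sum>s\<in>A. e s * h s)" for A h
    by (simp add: f_def sum.distrib sum_distrib_left sum_subtractf algebra_simps)
  then show "c_mean \<Sigma> i j f = (1 - r) * c_mean \<Sigma> i j d + r * c_mean \<Sigma> i j e"
    by (simp add: c_mean_def)
  show "is_design f"
    using assms(1,2,5,6) lin[where A = UNIV and h = "\<lambda>_. 1"] by (simp add: is_design_def) (simp add: f_def)
  have eq: "equireplicated d" "equireplicated e"
    using assms(3,4) by (simp_all add: pseudo_symmetric_def equireplicated_def)
  have eqf: "equireplicated f"
  proof -
    have "(\<Sum>s\<in>A. f s) = (1 - r) * (\<Sum>s\<in>A. d s) + r * (\<Sum>s\<in>A. e s)" for A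
      using lin[where h = "\<lambda>_. 1"] by simp
    then show ?thesis using eq by (simp add: equireplicated_def flip: add_divide_distrib)
  qed
  have "C_d \<Sigma> n i j f = (1 - r) *\<^sub>R C_d \<Sigma> n i j d + r *\<^sub>R C_d \<Sigma> n i j e" for i j
    unfolding equireplicated_C_d[OF eq(1)] equireplicated_C_d[OF eq(2)] equireplicated_C_d[OF eqf]
    by (simp add: Chat_d_def f_def vec_eq_iff sum.distrib sum_subtractf sum_distrib_left algebra_simps)
  moreover have "completely_symmetric (a *\<^sub>R A + b *\<^sub>R B)"
    if cs: "completely_symmetric A" "completely_symmetric B" for a b and A B :: "real^'t^'t"
  proof -
    obtain x y x' y' where "A = x *\<^sub>R mat 1 + y *\<^sub>R J_mat" "B = x' *\<^sub>R mat 1 + y' *\<^sub>R J_mat"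
      using cs unfolding completely_symmetric_def by blast
    then have "a *\<^sub>R A + b *\<^sub>R B = (a * x + b * x') *\<^sub>R mat 1 + (a * y + b * y') *\<^sub>R J_mat"
      by (simp add: algebra_simps)
    then show ?thesis unfolding completely_symmetric_def by blast
  qed
  ultimately show "pseudo_symmetric \<Sigma> n f"
    using assms(3,4) eqf unfolding pseudo_symmetric_def equireplicated_def by auto
qed

text \<open>The first-order condition for a maximum at \<open>\<epsilon> = 0\<close>; the minimum of the
  mixed quadratic is written in closed form, so that its one-sided derivative is the quadratic of the
  new sequence at the old minimizer.\<close>

lemma mixture_derivative_condition:
  fixes a b c a' b' c' q q' :: real and k :: nat
  defines "h \<equiv> \<lambda>r. ((1 - r) * a + r * a') - ((1 - r) * b + r * b')\<^sup>2 / ((1 - r) * c + r * c')"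
    and "Q \<equiv> \<lambda>r. (1 - r) * q + r * q'"
    and "x \<equiv> - b / c"
  assumes c: "c > 0" and q: "q > 0" and h0: "h 0 > 0"
    and max: "\<And>r. 0 \<le> r \<Longrightarrow> r \<le> 1 \<Longrightarrow> h r * Q r ^ k \<le> h 0 * Q 0 ^ k"
  shows "1 / (real k + 1) * ((a' + 2 * b' * x + c' * x\<^sup>2) / h 0) + real k / (real k + 1) * (q' / q) \<le> 1"
proof -
  define A where "A = h 0"
  define A' where "A' = a' + 2 * b' * x + c' * x\<^sup>2"
  have "((\<lambda>r. h r) has_real_derivative ((a' - a) - (2 * b * (b' - b) * c - b\<^sup>2 * (c' - c)) / (c * c))) (at 0)"
    unfolding h_def using c
    by (auto intro!: derivative_eq_intros simp: algebra_simps power2_eq_square)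
  moreover have "(a' - a) - (2 * b * (b' - b) * c - b\<^sup>2 * (c' - c)) / (c * c) = A' - A"
    using c by (simp add: A'_def A_def h_def x_def power2_eq_square field_simps)
  ultimately have dh: "(h has_real_derivative (A' - A)) (at 0)" by simp
  have dQ: "(Q has_real_derivative (q' - q)) (at 0)"
    unfolding Q_def by (auto intro!: derivative_eq_intros)
  have Q0: "Q 0 = q" by (simp add: Q_def)
  \<comment> \<open>For \<open>k = 0\<close> the truncated exponent \<open>k - 1\<close> is
    harmless, as both sides carry the factor 0.\<close>
  have qk: "real k * q ^ (k - 1) = real k * q ^ k / q" using q by (cases k) simp_all
  define D where "D = (A' - A) * q ^ k + real k * q ^ (k - 1) * (q' - q) * A"
  have df: "((\<lambda>r. h r * Q r ^ k) has_real_derivative D) (at 0)"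
    unfolding D_def A_def
    by (auto intro!: derivative_eq_intros dh dQ simp: Q0 A_def)
  \<comment> \<open>A positive derivative would make the product exceed its value at 0 immediately
    to the right; capping \<open>r\<close> at 1 keeps it in the range of \<open>max\<close>.\<close>
  have "D \<le> 0"
  proof (rule ccontr)
    assume "\<not> D \<le> 0"
    then obtain s where s: "s > 0" "\<And>r. 0 < r \<Longrightarrow> r < s \<Longrightarrow> h 0 * Q 0 ^ k < h (0 + r) * Q (0 + r) ^ k"
      using DERIV_pos_inc_right[OF df] by auto
    define r where "r = min (s / 2) 1"
    have "0 < r" "r < s" "r \<le> 1" using s(1) by (auto simp: r_def)
    with s(2)[of r] max[of r] show False by simp
  qed
  moreover have "D = A * q ^ k * ((A' / A - 1) + real k * (q' / q - 1))"
    unfolding D_def qk using q h0[folded A_def] by (simp add: field_simps)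
  moreover have "A * q ^ k > 0" using q h0 by (simp add: A_def)
  ultimately have "(A' / A - 1) + real k * (q' / q - 1) \<le> 0" by (metis mult_le_0_iff not_less)
  then have "A' / A + real k * (q' / q) \<le> real k + 1" by (simp add: algebra_simps)
  then have "(A' / A + real k * (q' / q)) / (real k + 1) \<le> 1" by simp
  then show ?thesis by (simp add: A_def A'_def add_divide_distrib mult.commute)
qed

text \<open>\<open>D_ratio\<close> is linear in the quadratic of the sequence. Averaging over
  \<open>d\<close> itself gives 1; averaging over a competitor gives the quantity that bounds its
  criterion.\<close>

lemma D_ratio_mean:
  fixes d e :: "('p::{finite,linorder}, 't::finite) design"
  assumes "is_design e"
  shows "(\<Sum>s\<in>UNIV. e s * D_ratio \<Sigma> n lam d s)
    = 1 / (real CARD('t) - 1) * (q_d \<Sigma> e (x_d \<Sigma> n d) / q_d \<Sigma> d (x_d \<Sigma> n d))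
      + (real CARD('t) - 2) / (real CARD('t) - 1) * (q_d \<Sigma> e lam / q_d \<Sigma> d lam)"
proof -
  have "(\<Sum>s\<in>UNIV. e s * (c * (q_s \<Sigma> s x / z))) = c * (q_d \<Sigma> e x / z)" for c x z
    by (simp add: q_d_def sum_distrib_left sum_divide_distrib mult_ac)
  then show ?thesis by (simp add: D_ratio_def distrib_left sum.distrib del: times_divide_eq_right times_divide_eq_left)
qed

section \<open>The equivalence and the support of an optimal design\<close>

theorem theorem6:
  fixes \<Sigma> :: "('p::{finite,linorder}, 'p) rmat"
    and n :: nat
    and g :: "(real^'t::finite) measure"
    and lam0 :: real
    and d :: "('p, 't) design"
  assumes "CARD('p) \<ge> 2" and "CARD('t) \<ge> 2" and "n \<ge> 1"
    and "pos_definite \<Sigma>"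
    and "is_prior g" and "exchangeable g"
    and "is_design d" and "pseudo_symmetric \<Sigma> n d"
  shows "(D_optimal \<Sigma> n g lam0 d \<longleftrightarrow>
            q_d \<Sigma> d (x_d \<Sigma> n d) > 0 \<and> (MAX s. D_ratio \<Sigma> n lam0 d s) = 1)
       \<and> (D_optimal \<Sigma> n g lam0 d \<longrightarrow>
            (\<forall>s. d s > 0 \<longrightarrow> D_ratio \<Sigma> n lam0 d s = (MAX s'. D_ratio \<Sigma> n lam0 d s')))"
proof -
  note p = assms(1) and t = assms(2) and n = assms(3) and S = assms(4) and g = assms(5,6)
    and d = assms(7) and sym = assms(8)
  define m where "m = real CARD('t) - 1"
  define k where "k = CARD('t) - 2"
  have m: "m > 0" "m = real k + 1" and k: "CARD('t) - 1 = Suc k"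
    using t by (auto simp: m_def k_def of_nat_diff)
  define \<psi> where "\<psi> e = root (Suc k) (q_d \<Sigma> e (x_d \<Sigma> n e) * q_d \<Sigma> e lam0 ^ k)"
    for e :: "('p, 't) design"
  have crit: "D_criterion \<Sigma> n g lam0 e = n / m * \<psi> e"
    if "is_design e" "pseudo_symmetric \<Sigma> n e" for e :: "('p, 't) design"
    using pseudo_symmetric_D_criterion[OF p t n S g(1) that, of lam0]
    by (simp only: m_def \<psi>_def k_def[symmetric] k)
  define A where "A = q_d \<Sigma> d (x_d \<Sigma> n d)"
  define B where "B = q_d \<Sigma> d lam0"
  define R where "R = D_ratio \<Sigma> n lam0 d"
  \<comment> \<open>\<open>A\<close> is the minimum of the quadratic \<open>q_d\<close>, so
    positivity of \<open>A\<close> passes to \<open>B\<close>.\<close>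
  have AB: "A \<le> B" unfolding A_def B_def by (rule q_d_x_d(3)[OF p t S d n])
  have R_mean: "(\<Sum>s\<in>UNIV. e s * R s)
      = 1 / m * (q_d \<Sigma> e (x_d \<Sigma> n d) / A) + real k / m * (q_d \<Sigma> e lam0 / B)"
    if "is_design e" for e :: "('p, 't) design"
    using D_ratio_mean[OF that, of \<Sigma> n lam0 d] t
    by (simp add: R_def A_def B_def m_def k_def of_nat_diff)
  have Rd: "(\<Sum>s\<in>UNIV. d s * R s) = 1" if "A > 0"
    using R_mean[OF d] that AB m by (simp add: field_simps flip: A_def B_def)
  have d0: "\<And>s. d s \<ge> 0" and d1: "(\<Sum>s\<in>UNIV. d s) = 1" using d by (auto simp: is_design_def)
  \<comment> \<open>The mean of \<open>R\<close> under \<open>d\<close> is 1, so when no value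
    exceeds 1 the nonnegative terms \<open>d s * (1 - R s)\<close> sum to 0. This also shows that
    the maximum is attained.\<close>
  have support: "R s = 1" if "A > 0" "\<And>s. R s \<le> 1" "d s > 0" for s
  proof -
    have "(\<Sum>s\<in>UNIV. d s * (1 - R s)) = 0"
      using Rd[OF that(1)] d1 by (simp add: right_diff_distrib sum_subtractf)
    then have "\<forall>s\<in>UNIV. d s * (1 - R s) = 0"
      using d0 that(2) by (subst (asm) sum_nonneg_eq_0_iff) auto
    then show ?thesis using that(3) by (metis UNIV_I diff_eq_diff_eq diff_self less_irrefl mult_eq_0_iff)
  qed
  have "\<exists>s. d s \<noteq> 0" using d1 by (metis sum.neutral zero_neq_one)
  then obtain s0 where s0: "d s0 > 0" using d0 by (metis less_eq_real_def)
  have max_le: "R s \<le> (MAX s. R s)" for s by (rule Max_ge) auto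
  have max_1: "(MAX s. R s) = 1" if "A > 0" "\<And>s. R s \<le> 1"
    using support[OF that s0] that(2) by (intro Max_eqI) (auto simp: image_iff)

  have sufficient: "D_optimal \<Sigma> n g lam0 d" if A: "A > 0" and max: "(MAX s. R s) = 1"
  proof -
    have B: "B > 0" using A AB by simp
    define K where "K = \<psi> d"
    have K: "K = root (Suc k) (A * B ^ k)" by (simp add: K_def \<psi>_def A_def B_def)
    have K0: "K > 0" using A B by (simp add: K)
    have "K ^ Suc k = A * B ^ k" unfolding K using A B by (intro real_root_pow_pos2) auto
    \<comment> \<open>The choice of \<alpha> as \<open>K / A\<close> and \<beta> as
      \<open>K / B\<close> is admissible in \<open>D_criterion_le\<close> and turns its bound into
      \<open>n / m * K\<close> times the mean of \<open>R\<close> under the competitor.\<close>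
    then have norm: "(K / A) * (K / B) ^ (CARD('t) - 2) = 1"
      using A B by (simp add: k_def[symmetric] power_divide field_simps)
    have "D_criterion \<Sigma> n g lam0 e \<le> D_criterion \<Sigma> n g lam0 d" if e: "is_design e" for e :: "('p, 't) design"
    proof -
      have e0: "\<And>s. e s \<ge> 0" and e1: "(\<Sum>s\<in>UNIV. e s) = 1" using e by (auto simp: is_design_def)
      have k': "real CARD('t) - 2 = real k" using t by (simp add: k_def of_nat_diff)
      have "D_criterion \<Sigma> n g lam0 e
          \<le> n / m * (1 / m * (K / A * q_d \<Sigma> e (x_d \<Sigma> n d)) + real k / m * (K / B * q_d \<Sigma> e lam0))"
        using D_criterion_le[OF t S e g _ _ norm, of n lam0 "x_d \<Sigma> n d"] A B K0
        unfolding k' m_def[symmetric] by simp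
      also have "\<dots> = n / m * K * (\<Sum>s\<in>UNIV. e s * R s)"
        unfolding R_mean[OF e] by (simp add: algebra_simps)
      also have "\<dots> \<le> n / m * K * (\<Sum>s\<in>UNIV. e s * 1)"
        using e0 max_le[unfolded max] m(1) K0 by (intro mult_left_mono sum_mono) auto
      also have "\<dots> = D_criterion \<Sigma> n g lam0 d"
        by (simp add: e1 crit[OF d sym] K_def)
      finally show ?thesis .
    qed
    then show ?thesis using d by (simp add: D_optimal_def)
  qed

  have necessary: "A > 0 \<and> (\<forall>s. R s \<le> 1)" if opt: "D_optimal \<Sigma> n g lam0 d"
  proof -
    have le: "q_d \<Sigma> e (x_d \<Sigma> n e) * q_d \<Sigma> e lam0 ^ k \<le> A * B ^ k"
      if e: "is_design e" "pseudo_symmetric \<Sigma> n e" for e :: "('p, 't) design"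
    proof -
      have "n / m * \<psi> e \<le> n / m * \<psi> d"
        using opt e unfolding D_optimal_def crit[OF e, symmetric] crit[OF d sym, symmetric] by blast
      then have "\<psi> e \<le> \<psi> d" by (rule mult_left_le_imp_le) (use n m(1) in auto)
      then show ?thesis by (simp add: \<psi>_def A_def B_def)
    qed
    \<comment> \<open>The uniform design is invariant under relabelling and all its quadratics are
      positive. Comparison with it shows that the product \<open>A * B ^ k\<close> is positive at an
      optimum, which excludes \<open>A = 0\<close>.\<close>
    define u :: "('p, 't) design" where "u = (\<lambda>_. 1 / real CARD('p \<Rightarrow> 't))"
    have u: "is_design u" by (simp add: is_design_def u_def)
    have "q_d \<Sigma> u x > 0" for x
    proof -
      obtain s :: "'p \<Rightarrow> 't" where "q_s \<Sigma> s x > 0" using ex_q_s_pos[OF p t S] by blast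
      then have "0 < u s * q_s \<Sigma> s x" by (simp add: u_def)
      also have "\<dots> \<le> q_d \<Sigma> u x"
        unfolding q_d_def by (intro member_le_sum) (auto simp: u_def q_s_nonneg[OF S])
      finally show ?thesis .
    qed
    then have "0 < q_d \<Sigma> u (x_d \<Sigma> n u) * q_d \<Sigma> u lam0 ^ k" by simp
    also have "\<dots> \<le> A * B ^ k"
      by (rule le[OF u permutation_invariant_pseudo_symmetric[OF t u]]) (simp add: u_def)
    finally have "A \<noteq> 0" by auto
    moreover have "A \<ge> 0" unfolding A_def by (rule q_d_nonneg[OF S d])
    ultimately have A: "A > 0" by simp
    then have B: "B > 0" using AB by simp
    have "R s \<le> 1" for s
    proof -
      \<comment> \<open>The orbit design stands in for the sequence \<open>s\<close>, so that every
        mixture with \<open>d\<close> stays pseudo symmetric, where the criterion is known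
        exactly.\<close>
      define o' where "o' = orbit_design s"
      note orb = orbit_design_facts[where s = s, folded o'_def]
      have sym_o: "pseudo_symmetric \<Sigma> n o'"
        by (rule permutation_invariant_pseudo_symmetric[OF t orb(1,2)])
      define mix where "mix r = (\<lambda>s. (1 - r) * d s + r * o' s)" for r
      note mix = pseudo_symmetric_mixture[OF d orb(1) sym sym_o, folded mix_def]
      let ?c = "\<lambda>i j. c_mean \<Sigma> i j d" and ?s = "\<lambda>i j. c_s \<Sigma> i j s"
      have x: "x_d \<Sigma> n d = - ?c 1 2 / ?c 2 2" by (rule q_d_x_d(1)[OF p t S d n])
      have A': "A = ?c 1 1 - (?c 1 2)\<^sup>2 / ?c 2 2" unfolding A_def by (rule q_d_x_d(2)[OF p t S d n])
      have q_mix: "q_d \<Sigma> (mix r) y = (1 - r) * q_d \<Sigma> d y + r * q_s \<Sigma> s y" if "0 \<le> r" "r \<le> 1" for r y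
        unfolding q_d_eq mix(3)[OF that] orb(3) q_s_def by (simp add: algebra_simps del: One_nat_def)
      \<comment> \<open>Optimality along the segment, written in the coefficients that
        \<open>mixture_derivative_condition\<close> expects.\<close>
      have max: "((1 - r) * ?c 1 1 + r * ?s 1 1 - ((1 - r) * ?c 1 2 + r * ?s 1 2)\<^sup>2 / ((1 - r) * ?c 2 2 + r * ?s 2 2))
            * ((1 - r) * B + r * q_s \<Sigma> s lam0) ^ k \<le> A * B ^ k" if r: "0 \<le> r" "r \<le> 1" for r
        using le[OF mix(1,2)[OF r]]
        unfolding q_d_x_d(2)[OF p t S mix(1)[OF r] n] mix(3)[OF r] orb(3) q_mix[OF r, of lam0] B_def .
      have "1 / (real k + 1) * ((?s 1 1 + 2 * ?s 1 2 * (- ?c 1 2 / ?c 2 2) + ?s 2 2 * (- ?c 1 2 / ?c 2 2)\<^sup>2) / A)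
          + real k / (real k + 1) * (q_s \<Sigma> s lam0 / B) \<le> 1"
        using mixture_derivative_condition[of "?c 2 2" B "?c 1 1" "?s 1 1" "?c 1 2" "?s 1 2" "?s 2 2" "q_s \<Sigma> s lam0" k,
            OF c_mean_22_pos[OF p t S d] B] A max
        by (simp add: A'[symmetric] del: One_nat_def)
      moreover have "q_s \<Sigma> s (x_d \<Sigma> n d)
          = ?s 1 1 + 2 * ?s 1 2 * (- ?c 1 2 / ?c 2 2) + ?s 2 2 * (- ?c 1 2 / ?c 2 2)\<^sup>2"
        by (simp only: q_s_def x)
      moreover have "R s = 1 / (real k + 1) * (q_s \<Sigma> s (x_d \<Sigma> n d) / A)
          + real k / (real k + 1) * (q_s \<Sigma> s lam0 / B)"
        using t by (simp add: R_def D_ratio_def A_def B_def k_def of_nat_diff)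
      ultimately show ?thesis by simp
    qed
    with A show ?thesis by blast
  qed

  show ?thesis
    using sufficient necessary max_1 support unfolding A_def[symmetric] R_def[symmetric] by metis
qed

end
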